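(* Let $R$ be an associative ring with identity and pseudo-involution, let $(V,B,\mathfrak L)$ be an odd quadratic space over $R$, and let $n\geq 5$ be an integer or $n=\infty$. Let $\mathrm{StU}(2n,R,\mathfrak L)$ be the odd unitary Steinberg group. Then its Schur multiplier is trivial: $\mathrm M(\mathrm{StU}(2n,R,\mathfrak L))=1$.
   Context: Odd quadratic spaces. A pseudo-involution on an associative ring $R$ with identity is an additive map $\overline{\phantom a}:R\to R$ such that $\overline 1$ is invertible, $\overline{\overline a}=a$ and $\overline{ab}=\overline b\,\overline1^{-1}\overline a$. An anti-Hermitian form on a right $R$-module $V$ is a biadditive map $B:V\times V\to R$ with $B(ua,vb)=\overline a\,\overline1^{-1}B(u,v)b$ and $B(u,v)=-\overline{B(v,u)}$. The Heisenberg group $\mathfrak H$ of $B$ is the set $V\times R$ with group law $(u,a)\dotplus(v,b)=(u+v,\,a+b+B(u,v))$; inverses are $\dot-(u,a)=(-u,-a+B(u,u))$. $R$ acts on $\mathfrak H$ on the right by $(u,a)\leftharpoonup b=(ub,\,\overline b\,\overline1^{-1}ab)$. An odd form parameter is a subgroup $\mathfrak L\leq\mathfrak H$ stable under the action of $R$ with $\mathfrak L_{\min}\leq\mathfrak L\leq\mathfrak L_{\max}$, where $\mathfrak L_{\min}=\{(0,a+\overline a)\mid a\in R\}$ and $\mathfrak L_{\max}=\{(u,a)\mid a=\overline a+B(u,u)\}$. The triple $(V,B,\mathfrak L)$ is called an odd quadratic space. Odd unitary Steinberg group. For an integer $n\ge3$ put $\Omega=\{1,\dots,n,-n,\dots,-1\}$,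 and $\varepsilon_i=\overline1^{-1}$ for $i>0$, $\varepsilon_i=-1$ for $i<0$. Commutators are $[x,y]=xyx^{-1}y^{-1}$. $\mathrm{StU}(2n,R,\mathfrak L)$ is the group with generators $X_{ij}(a)$ ($i,j\in\Omega$, $i\notin\{\pm j\}$, $a\in R$) and $X_i(\xi)$ ($i\in\Omega$, $\xi\in\mathfrak L$), and relations (for all indices and parameters for which the symbols are defined): (R0) $X_{ij}(a)=X_{-j,-i}(\varepsilon_{-j}\overline a\varepsilon_i)$; (R1) $X_{ij}(a)X_{ij}(b)=X_{ij}(a+b)$; (R2) $X_i(\xi)X_i(\zeta)=X_i(\xi\dotplus\zeta)$; (R3) $[X_{ij}(a),X_{hk}(b)]=1$ for $h\notin\{j,-i\}$, $k\notin\{i,-j\}$; (R4) $[X_i(\xi),X_{jk}(a)]=1$ for $j\ne-i$, $k\neq i$; (R5) $[X_{ij}(a),X_{jk}(b)]=X_{ik}(ab)$; (R6) $[X_i(u,a),X_j(v,b)]=X_{i,-j}(\varepsilon_iB(u,v))$ for $i\notin\{\pm j\}$; (R7) $[X_i(u,a),X_i(v,b)]=X_i(0,B(u,v)-B(v,u))$; (R8) $[X_i(u,a),X_{-i,j}(b)]=X_{ij}(\varepsilon_iab)\,X_{-j}((u,-\overline a)\leftharpoonup b)$; (R9) $[X_{ij}(a),X_{j,-i}(b)]=X_i(0,-\varepsilon_{-i}\overline1ab+\overline b\,\overline1^{-1}\overline a\varepsilon_i)$. For $n=\infty$, $\mathrm{StU}(\infty,R,\mathfrak L)$ is the direct limit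 of the groups $\mathrm{StU}(2n,R,\mathfrak L)$ along the maps $\mathrm{StU}(2n,R,\mathfrak L)\to\mathrm{StU}(2n+2,R,\mathfrak L)$ sending $X_{ij}(a)\mapsto X_{ij}(a)$, $X_i(\xi)\mapsto X_i(\xi)$. Schur multiplier. A central extension of a group $G$ is an epimorphism $\epsilon:H\to G$ whose kernel lies in the center of $H$. A central extension $\pi:U\to G$ is universal if for every central extension $\epsilon:H\to G$ there is a unique homomorphism $\eta:U\to H$ with $\epsilon\eta=\pi$. Such $\pi$ exists exactly when $G$ is perfect ($G=[G,G]$), and the Schur multiplier of a perfect group $G$ is $\mathrm M(G)=\mathrm{Ker}(\pi)$ (well defined up to isomorphism). The group $\mathrm{StU}(2n,R,\mathfrak L)$ is perfect. *)

theory Defs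
  imports "HOL-Algebra.Elementary_Groups"
begin

section \<open>Odd quadratic spaces\<close>

text \<open>
  Rings are types of sort \<open>{ring, monoid_mult}\<close>: associative with identity, and, unlike
  in the class \<open>ring_1\<close>, the zero ring is allowed.
\<close>

definition ring_inverse :: "'r::monoid_mult \<Rightarrow> 'r" where
  "ring_inverse x = (THE y. x * y = 1 \<and> y * x = 1)"

locale pseudo_involution =
  fixes bar :: "'r::{ring, monoid_mult} \<Rightarrow> 'r"
  assumes bar_add: "bar (a + b) = bar a + bar b"
    and bar_one_invertible: "\<exists>y. bar 1 * y = 1 \<and> y * bar 1 = 1"
    and bar_bar: "bar (bar a) = a"
    and bar_mult: "bar (a * b) = bar b * ring_inverse (bar 1) * bar a"

locale anti_hermitian_form = pseudo_involution bar
  for bar :: "'r::{ring, monoid_mult} \<Rightarrow> 'r" +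
  fixes act :: "'v::ab_group_add \<Rightarrow> 'r \<Rightarrow> 'v"
    and B :: "'v \<Rightarrow> 'v \<Rightarrow> 'r"
  assumes act_add_left: "act (u + v) a = act u a + act v a"
    and act_add_right: "act u (a + b) = act u a + act u b"
    and act_mult: "act u (a * b) = act (act u a) b"
    and act_one: "act u 1 = u"
    and form_add_left: "B (u + u') v = B u v + B u' v"
    and form_add_right: "B u (v + v') = B u v + B u v'"
    and form_act: "B (act u a) (act v b) = bar a * ring_inverse (bar 1) * B u v * b"
    and form_anti: "B u v = - bar (B v u)"
begin

definition heisenberg :: "('v \<times> 'r) monoid" where
  "heisenberg =
     \<lparr>carrier = UNIV,
      mult = (\<lambda>(u, a) (v, b). (u + v, a + b + B u v)),
      one = (0, 0)\<rparr>"

definition heis_act :: "'v \<times> 'r \<Rightarrow> 'r \<Rightarrow> 'v \<times> 'r" where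
  "heis_act \<xi> b = (case \<xi> of (u, a) \<Rightarrow> (act u b, bar b * ring_inverse (bar 1) * a * b))"

definition L_min :: "('v \<times> 'r) set" where
  "L_min = {(0, a + bar a) | a. True}"

definition L_max :: "('v \<times> 'r) set" where
  "L_max = {(u, a). a = bar a + B u u}"

end

locale odd_quadratic_space = anti_hermitian_form bar act B
  for bar :: "'r::{ring, monoid_mult} \<Rightarrow> 'r"
    and act :: "'v::ab_group_add \<Rightarrow> 'r \<Rightarrow> 'v"
    and B :: "'v \<Rightarrow> 'v \<Rightarrow> 'r" +
  fixes L :: "('v \<times> 'r) set"
  assumes L_subgroup: "subgroup L heisenberg"
    and L_act: "\<xi> \<in> L \<Longrightarrow> heis_act \<xi> b \<in> L"
    and L_min_subset: "L_min \<subseteq> L"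
    and L_subset_max: "L \<subseteq> L_max"


section \<open>Groups given by generators and relations\<close>

text \<open>
  In a word, \<open>(x, True)\<close> stands for the generator \<open>x\<close> and \<open>(x, False)\<close> for its inverse.
\<close>

type_synonym 'x word = "('x \<times> bool) list"

definition words_over :: "'x set \<Rightarrow> 'x word set" where
  "words_over X = lists (X \<times> UNIV)"

definition word_inv :: "'x word \<Rightarrow> 'x word" where
  "word_inv w = rev (map (\<lambda>(x, b). (x, \<not> b)) w)"

definition word_comm :: "'x word \<Rightarrow> 'x word \<Rightarrow> 'x word" where
  "word_comm v w = v @ w @ word_inv v @ word_inv w"

text \<open>
  Only those pairs of \<open>R\<close> count whose two sides are words over \<open>X\<close>; in this way a relation
  is imposed exactly when all symbols in it are defined.
\<close>

inductive_set word_equiv :: "'x set \<Rightarrow> 'x word rel \<Rightarrow> 'x word rel"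
  for X :: "'x set" and R :: "'x word rel" where
  refl: "w \<in> words_over X \<Longrightarrow> (w, w) \<in> word_equiv X R"
| sym: "(v, w) \<in> word_equiv X R \<Longrightarrow> (w, v) \<in> word_equiv X R"
| trans: "(u, v) \<in> word_equiv X R \<Longrightarrow> (v, w) \<in> word_equiv X R \<Longrightarrow> (u, w) \<in> word_equiv X R"
| append: "(v, v') \<in> word_equiv X R \<Longrightarrow> (w, w') \<in> word_equiv X R
    \<Longrightarrow> (v @ w, v' @ w') \<in> word_equiv X R"
| cancel: "x \<in> X \<Longrightarrow> ([(x, b), (x, \<not> b)], []) \<in> word_equiv X R"
| relation: "(v, w) \<in> R \<Longrightarrow> v \<in> words_over X \<Longrightarrow> w \<in> words_over X
    \<Longrightarrow> (v, w) \<in> word_equiv X R"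

definition presented_group :: "'x set \<Rightarrow> 'x word rel \<Rightarrow> 'x word set monoid" where
  "presented_group X R =
     \<lparr>carrier = words_over X // word_equiv X R,
      mult = (\<lambda>P Q. \<Union>v\<in>P. \<Union>w\<in>Q. word_equiv X R `` {v @ w}),
      one = word_equiv X R `` {[]}\<rparr>"


section \<open>Direct limits of sequences of groups\<close>

text \<open>
  \<open>f i\<close> is the transition map from \<open>G i\<close> to \<open>G (Suc i)\<close>, and the sequence starts at \<open>m\<close>.
  The composite map from \<open>G i\<close> to \<open>G k\<close> is \<open>fold f [i..<k]\<close>.
\<close>

definition direct_limit_rel ::
    "nat \<Rightarrow> (nat \<Rightarrow> 'g monoid) \<Rightarrow> (nat \<Rightarrow> 'g \<Rightarrow> 'g) \<Rightarrow> (nat \<times> 'g) rel" where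
  "direct_limit_rel m G f =
     {((i, x), (j, y)). m \<le> i \<and> x \<in> carrier (G i) \<and> m \<le> j \<and> y \<in> carrier (G j) \<and>
        (\<exists>k. i \<le> k \<and> j \<le> k \<and> fold f [i..<k] x = fold f [j..<k] y)}"

definition direct_limit ::
    "nat \<Rightarrow> (nat \<Rightarrow> 'g monoid) \<Rightarrow> (nat \<Rightarrow> 'g \<Rightarrow> 'g) \<Rightarrow> (nat \<times> 'g) set monoid" where
  "direct_limit m G f =
     \<lparr>carrier = (SIGMA i:{m..}. carrier (G i)) // direct_limit_rel m G f,
      mult = (\<lambda>P Q. \<Union>(i, x)\<in>P. \<Union>(j, y)\<in>Q.
        direct_limit_rel m G f ``
          {(max i j,
            fold f [i..<max i j] x \<otimes>\<^bsub>G (max i j)\<^esub> fold f [j..<max i j] y)}),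
      one = direct_limit_rel m G f `` {(m, \<one>\<^bsub>G m\<^esub>)}\<rparr>"


section \<open>Odd unitary Steinberg groups\<close>

text \<open>The symbols \<open>X\<^sub>i\<^sub>j(a)\<close> and \<open>X\<^sub>i(\<xi>)\<close>.\<close>

datatype ('v, 'r) steinberg_gen = Short int int 'r | Long int "'v \<times> 'r"

definition Omega :: "nat \<Rightarrow> int set" where
  "Omega n = {i. i \<noteq> 0 \<and> \<bar>i\<bar> \<le> int n}"

abbreviation XS :: "int \<Rightarrow> int \<Rightarrow> 'r \<Rightarrow> ('v, 'r) steinberg_gen word" where
  "XS i j a \<equiv> [(Short i j a, True)]"

abbreviation XL :: "int \<Rightarrow> 'v \<times> 'r \<Rightarrow> ('v, 'r) steinberg_gen word" where
  "XL i \<xi> \<equiv> [(Long i \<xi>, True)]"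

context odd_quadratic_space
begin

definition eps :: "int \<Rightarrow> 'r" where
  "eps i = (if i > 0 then ring_inverse (bar 1) else - 1)"

definition steinberg_gens :: "nat \<Rightarrow> ('v, 'r) steinberg_gen set" where
  "steinberg_gens n =
     {Short i j a | i j a. i \<in> Omega n \<and> j \<in> Omega n \<and> i \<notin> {j, - j}} \<union>
     {Long i \<xi> | i \<xi>. i \<in> Omega n \<and> \<xi> \<in> L}"

inductive_set steinberg_rels :: "('v, 'r) steinberg_gen word rel" where
  R0: "(XS i j a, XS (- j) (- i) (eps (- j) * bar a * eps i)) \<in> steinberg_rels"
| R1: "(XS i j a @ XS i j b, XS i j (a + b)) \<in> steinberg_rels"
| R2: "(XL i \<xi> @ XL i \<zeta>, XL i (\<xi> \<otimes>\<^bsub>heisenberg\<^esub> \<zeta>)) \<in> steinberg_rels"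
| R3: "h \<notin> {j, - i} \<Longrightarrow> k \<notin> {i, - j} \<Longrightarrow>
    (word_comm (XS i j a) (XS h k b), []) \<in> steinberg_rels"
| R4: "j \<noteq> - i \<Longrightarrow> k \<noteq> i \<Longrightarrow>
    (word_comm (XL i \<xi>) (XS j k a), []) \<in> steinberg_rels"
| R5: "(word_comm (XS i j a) (XS j k b), XS i k (a * b)) \<in> steinberg_rels"
| R6: "i \<notin> {j, - j} \<Longrightarrow>
    (word_comm (XL i (u, a)) (XL j (v, b)), XS i (- j) (eps i * B u v)) \<in> steinberg_rels"
| R7: "(word_comm (XL i (u, a)) (XL i (v, b)), XL i (0, B u v - B v u)) \<in> steinberg_rels"
| R8: "(word_comm (XL i (u, a)) (XS (- i) j b),
     XS i j (eps i * a * b) @ XL (- j) (heis_act (u, - bar a) b)) \<in> steinberg_rels"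
| R9: "(word_comm (XS i j a) (XS j (- i) b),
     XL i (0, - eps (- i) * bar 1 * a * b + bar b * ring_inverse (bar 1) * bar a * eps i))
       \<in> steinberg_rels"

text \<open>This is \<open>StU(2n, R, L)\<close>: the argument is half of the size.\<close>

definition StU :: "nat \<Rightarrow> ('v, 'r) steinberg_gen word set monoid" where
  "StU n = presented_group (steinberg_gens n) steinberg_rels"

definition StU_step ::
    "nat \<Rightarrow> ('v, 'r) steinberg_gen word set \<Rightarrow> ('v, 'r) steinberg_gen word set" where
  "StU_step n P = (\<Union>w\<in>P. word_equiv (steinberg_gens (Suc n)) steinberg_rels `` {w})"

definition StU_inf :: "(nat \<times> ('v, 'r) steinberg_gen word set) set monoid" where
  "StU_inf = direct_limit 3 StU StU_step"

end


section \<open>Schur multipliers\<close>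

definition central_extension ::
    "('h, 'm) monoid_scheme \<Rightarrow> ('g, 'n) monoid_scheme \<Rightarrow> ('h \<Rightarrow> 'g) \<Rightarrow> bool" where
  "central_extension H G \<epsilon> \<longleftrightarrow> group H \<and> group G \<and> \<epsilon> \<in> epi H G \<and>
     (\<forall>z\<in>kernel H G \<epsilon>. \<forall>x\<in>carrier H. z \<otimes>\<^bsub>H\<^esub> x = x \<otimes>\<^bsub>H\<^esub> z)"

text \<open>
  Since HOL cannot quantify over types, the type \<open>'h\<close> of the groups \<open>H\<close> against which
  universality is tested is a parameter. Homomorphisms are taken to be extensional, so that
  uniqueness means uniqueness on the carrier.
\<close>

definition universal_central_extension ::
    "'h itself \<Rightarrow> ('u, 'm) monoid_scheme \<Rightarrow> ('g, 'n) monoid_scheme \<Rightarrow> ('u \<Rightarrow> 'g) \<Rightarrow> bool" where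
  "universal_central_extension (T :: 'h itself) U G \<pi> \<longleftrightarrow> central_extension U G \<pi> \<and>
     (\<forall>(H :: 'h monoid) \<epsilon>. central_extension H G \<epsilon> \<longrightarrow>
       (\<exists>!\<eta>. \<eta> \<in> hom U H \<inter> extensional (carrier U) \<and>
             (\<forall>x\<in>carrier U. \<epsilon> (\<eta> x) = \<pi> x)))"

definition is_schur_multiplier ::
    "'h itself \<Rightarrow> ('g, 'n) monoid_scheme \<Rightarrow> 'u monoid \<Rightarrow> bool" where
  "is_schur_multiplier T G M \<longleftrightarrow>
     (\<exists>(U :: 'u monoid) \<pi>. universal_central_extension T U G \<pi> \<and>
        M = U\<lparr>carrier := kernel U G \<pi>\<rparr>)"

text \<open>
  The first conjunct says that a universal central extension exists (if its kernel is trivial,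
  it has a model on the type of \<open>G\<close> itself), the second that the kernel of each one is trivial.
  The second conjunct asks for universality only against groups on the type of \<open>U\<close> itself, which
  every truly universal extension satisfies. To be used for an arbitrary type \<open>'h\<close>.
\<close>

definition schur_multiplier_trivial :: "'h itself \<Rightarrow> 'g monoid \<Rightarrow> bool" where
  "schur_multiplier_trivial (T :: 'h itself) G \<longleftrightarrow>
     (\<exists>M :: 'g monoid. is_schur_multiplier T G M \<and> trivial_group M) \<and>
     (\<forall>M :: 'h monoid. is_schur_multiplier T G M \<longrightarrow> trivial_group M)"

end

theory Submission
  imports Defs
begin

text \<open>
  Let \<open>G\<close> be one of the Steinberg groups.  Since \<open>G\<close> is perfect, its Schur multiplier is trivial
  as soon as every central extension \<open>\<pi> : H \<rightarrow> G\<close> splits.  As \<open>G\<close> is given by generators and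
  relations, a splitting is a choice of lifts of the generators to \<open>H\<close> for which the relations hold
  exactly, and not only up to central elements.  The lifts are found by Steinberg's method: a
  commutator does not change when its entries are multiplied by central elements, so for
  \<open>g, h \<in> G\<close> the commutator \<open>{g, h} \<in> H\<close> of arbitrary lifts is well defined
  (\<open>comm_lift_unique\<close>), and the lifts are built from such commutators.

  \<^item> If two generators commute by (R3) or (R4), then all their lifts commute.  Indeed, write the short
    one as \<open>X\<^sub>h\<^sub>k(b) = [X\<^sub>h\<^sub>l(b), X\<^sub>l\<^sub>k(1)]\<close> with \<open>l\<close> different, up to sign, from all indices
    that occur.  Both factors commute with the other generator up to central elements, so their
    commutator commutes with it exactly.  A pair as in (R3) can occupy four indices; this is where
    \<open>n \<ge> 5\<close> enters (\<open>lifts_commute_short_short\<close>, \<open>lifts_commute_long_short\<close>).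
  \<^item> The commutator \<open>{X\<^sub>i\<^sub>l(a), X\<^sub>l\<^sub>j(b)}\<close> depends on \<open>i, j\<close> and the product \<open>ab\<close> only, and is taken as
    the lift of \<open>X\<^sub>i\<^sub>j(ab)\<close> (\<open>comm_short_short\<close>).  This gives the relations between short roots.
  \<^item> Relation (R8) with \<open>b = 1\<close> expresses \<open>X\<^sub>j(u, a)\<close> by short root elements and the commutator
    of \<open>X\<^sub>k\<close> and \<open>X\<^bsub>-k,-j\<^esub>\<close>; this dictates the lift of a long root element, at first depending on
    the auxiliary index \<open>k\<close>.  For these lifts one computes (R6), and from it the additivity (R2)
    (\<open>comm_lifts_long_long\<close>, \<open>yl_via_R2\<close>).
  \<^item> The commutator \<open>{X\<^sub>i\<^sub>j(a), X\<^bsub>j,-i\<^esub>(b)}\<close> depends on \<open>i\<close> and \<open>ab\<close> only, and it is the lift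
    of the long root element prescribed by (R9) (\<open>comm_opposite\<close>, \<open>yl_via_zero\<close>).
  \<^item> Expanding \<open>{X\<^sub>i(u, a), X\<^bsub>-i,j\<^esub>(b)}\<close> through a third index then yields (R8) and the independence
    of the auxiliary index at once (\<open>comm_long_short\<close>, \<open>yl_via_indep_apart\<close>).

  Two splittings agree on commutators, and every generator is a product of commutators; hence the
  splitting is unique (\<open>sections_unique\<close>).

  The argument uses the set of indices only through its symmetry and its size.  It is therefore
  carried out for an arbitrary group that contains a system of elements satisfying the relations,
  indexed by an arbitrary symmetric set.  The direct limit is then the case in which all nonzero
  integers are indices: each relation involves finitely many of them, and a compatible system of
  homomorphisms on the finite stages extends to the limit.
\<close>


section \<open>Commutators\<close>

definition conjg :: "('a, 'm) monoid_scheme \<Rightarrow> 'a \<Rightarrow> 'a \<Rightarrow> 'a" where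
  "conjg G x y = x \<otimes>\<^bsub>G\<^esub> y \<otimes>\<^bsub>G\<^esub> inv\<^bsub>G\<^esub> x"

definition comm :: "('a, 'm) monoid_scheme \<Rightarrow> 'a \<Rightarrow> 'a \<Rightarrow> 'a" where
  "comm G x y = x \<otimes>\<^bsub>G\<^esub> y \<otimes>\<^bsub>G\<^esub> inv\<^bsub>G\<^esub> x \<otimes>\<^bsub>G\<^esub> inv\<^bsub>G\<^esub> y"

context group
begin

lemma cancel_inv [simp]:
  assumes "x \<in> carrier G" "y \<in> carrier G"
  shows "x \<otimes> (inv x \<otimes> y) = y" "inv x \<otimes> (x \<otimes> y) = y"
  using assms by (simp_all flip: m_assoc)

lemmas group_word = m_assoc inv_mult_group

lemma conjg_closed [simp]: "\<lbrakk>x \<in> carrier G; y \<in> carrier G\<rbrakk> \<Longrightarrow> conjg G x y \<in> carrier G"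
  and comm_closed [simp]: "\<lbrakk>x \<in> carrier G; y \<in> carrier G\<rbrakk> \<Longrightarrow> comm G x y \<in> carrier G"
  by (simp_all add: conjg_def comm_def)

lemma conjg_mult:
  "\<lbrakk>x \<in> carrier G; y \<in> carrier G; z \<in> carrier G\<rbrakk>
    \<Longrightarrow> conjg G x (y \<otimes> z) = conjg G x y \<otimes> conjg G x z"
  by (simp add: conjg_def group_word)

lemma conjg_inv:
  "\<lbrakk>x \<in> carrier G; y \<in> carrier G\<rbrakk> \<Longrightarrow> conjg G x (inv y) = inv (conjg G x y)"
  by (simp add: conjg_def group_word)

lemma mult_conjg:
  "\<lbrakk>x \<in> carrier G; y \<in> carrier G; z \<in> carrier G\<rbrakk>
    \<Longrightarrow> conjg G (x \<otimes> y) z = conjg G x (conjg G y z)"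
  by (simp add: conjg_def group_word)

lemma conjg_comm:
  "\<lbrakk>x \<in> carrier G; y \<in> carrier G; z \<in> carrier G\<rbrakk>
    \<Longrightarrow> conjg G x (comm G y z) = comm G (conjg G x y) (conjg G x z)"
  by (simp add: comm_def conjg_mult conjg_inv)

lemma conjg_eq_comm_mult:
  "\<lbrakk>x \<in> carrier G; y \<in> carrier G\<rbrakk> \<Longrightarrow> conjg G x y = comm G x y \<otimes> y"
  by (simp add: conjg_def comm_def group_word)

lemma comm_eq_conjg_mult: "comm G x y = conjg G x y \<otimes> inv y"
  by (simp add: conjg_def comm_def)

lemma conjg_commuting:
  "\<lbrakk>x \<in> carrier G; y \<in> carrier G; x \<otimes> y = y \<otimes> x\<rbrakk> \<Longrightarrow> conjg G x y = y"
  by (simp add: conjg_def group_word)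

lemma comm_one_iff:
  assumes "x \<in> carrier G" "y \<in> carrier G"
  shows "comm G x y = \<one> \<longleftrightarrow> x \<otimes> y = y \<otimes> x"
proof
  have "x \<otimes> y = comm G x y \<otimes> (y \<otimes> x)"
    using assms by (simp add: comm_def group_word)
  then show "x \<otimes> y = y \<otimes> x" if "comm G x y = \<one>"
    using that assms by simp
next
  assume "x \<otimes> y = y \<otimes> x"
  then have "comm G x y = y \<otimes> x \<otimes> inv x \<otimes> inv y"
    by (simp add: comm_def)
  then show "comm G x y = \<one>"
    using assms by (simp add: m_assoc)
qed

lemma comm_inverse:
  "\<lbrakk>x \<in> carrier G; y \<in> carrier G\<rbrakk> \<Longrightarrow> inv (comm G x y) = comm G y x"
  by (simp add: comm_def group_word)

lemma commute_mult:
  assumes "x \<in> carrier G" "y \<in> carrier G" "z \<in> carrier G"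
    and "x \<otimes> y = y \<otimes> x" "x \<otimes> z = z \<otimes> x"
  shows "x \<otimes> (y \<otimes> z) = y \<otimes> z \<otimes> x"
  using assms by (metis m_assoc)

lemma commute_inv:
  assumes "x \<in> carrier G" "y \<in> carrier G" "x \<otimes> y = y \<otimes> x"
  shows "x \<otimes> inv y = inv y \<otimes> x"
proof -
  have "x \<otimes> inv y = inv y \<otimes> (y \<otimes> x) \<otimes> inv y"
    using assms(1,2) by (simp add: m_assoc)
  also have "\<dots> = inv y \<otimes> x"
    unfolding assms(3)[symmetric] using assms(1,2) by (simp add: m_assoc)
  finally show ?thesis .
qed

lemma commute_comm:
  assumes "x \<in> carrier G" "y \<in> carrier G" "z \<in> carrier G"
    and "x \<otimes> y = y \<otimes> x" "x \<otimes> z = z \<otimes> x"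
  shows "x \<otimes> comm G y z = comm G y z \<otimes> x"
  unfolding comm_def using assms by (intro commute_mult commute_inv) auto

lemma commute_left:
  assumes "x \<otimes> y = y \<otimes> x" "x \<in> carrier G" "y \<in> carrier G" "z \<in> carrier G"
  shows "x \<otimes> (y \<otimes> z) = y \<otimes> (x \<otimes> z)"
  using assms by (metis m_assoc)

lemma comm_mult_left:
  "\<lbrakk>x \<in> carrier G; y \<in> carrier G; z \<in> carrier G\<rbrakk>
    \<Longrightarrow> comm G (x \<otimes> y) z = conjg G x (comm G y z) \<otimes> comm G x z"
  by (simp add: conjg_def comm_def group_word)

lemma comm_mult_right:
  "\<lbrakk>x \<in> carrier G; y \<in> carrier G; z \<in> carrier G\<rbrakk>
    \<Longrightarrow> comm G x (y \<otimes> z) = comm G x y \<otimes> conjg G y (comm G x z)"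
  by (simp add: conjg_def comm_def group_word)

lemma comm_inv_right:
  assumes [simp]: "x \<in> carrier G" "y \<in> carrier G" and c: "y \<otimes> comm G x y = comm G x y \<otimes> y"
  shows "comm G x (inv y) = inv (comm G x y)"
proof -
  have "comm G x (inv y) = conjg G (inv y) (inv (comm G x y))"
    by (simp add: conjg_def comm_def group_word)
  also have "\<dots> = inv (comm G x y)"
    using commute_inv[OF _ _ commute_inv[OF _ _ c, symmetric]] by (simp add: conjg_commuting)
  finally show ?thesis .
qed

lemma comm_inv_left:
  assumes [simp]: "x \<in> carrier G" "y \<in> carrier G" and c: "x \<otimes> comm G x y = comm G x y \<otimes> x"
  shows "comm G (inv x) y = inv (comm G x y)"
proof -
  have "comm G (inv x) y = conjg G (inv x) (inv (comm G x y))"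
    by (simp add: conjg_def comm_def group_word)
  also have "\<dots> = inv (comm G x y)"
    using commute_inv[OF _ _ commute_inv[OF _ _ c, symmetric]] by (simp add: conjg_commuting)
  finally show ?thesis .
qed

text \<open>
  This and the four lemmas below are the computations behind the relations in a central extension,
  freed of root indices.  Here, conjugation by \<open>a\<close> fixes \<open>z\<close> and multiplies \<open>y\<close> by \<open>[a, y]\<close>; so
  \<open>[a, [y, z]]\<close> is what is left of \<open>[[a, y] y, z]\<close> after division by \<open>[y, z]\<close>.
\<close>

lemma comm_comm_eq:
  assumes [simp]: "a \<in> carrier G" "y \<in> carrier G" "z \<in> carrier G"
    and az: "a \<otimes> z = z \<otimes> a"
    and 1: "comm G a y \<otimes> comm G y z = comm G y z \<otimes> comm G a y"
    and 2: "comm G y z \<otimes> comm G (comm G a y) z = comm G (comm G a y) z \<otimes> comm G y z"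
  shows "comm G a (comm G y z) = comm G (comm G a y) z"
proof -
  have "conjg G a (comm G y z) = comm G (comm G a y \<otimes> y) z"
    using az by (simp add: conjg_comm conjg_commuting flip: conjg_eq_comm_mult)
  also have "\<dots> = comm G y z \<otimes> comm G (comm G a y) z"
    using 1 by (simp add: comm_mult_left conjg_commuting)
  also have "\<dots> = comm G (comm G a y) z \<otimes> comm G y z"
    by (rule 2)
  finally show ?thesis
    by (simp add: comm_eq_conjg_mult[of _ "comm G y z"] m_assoc)
qed

text \<open>
  Applied with \<open>P = X\<^sub>i\<^sub>k\<close>, \<open>Q = X\<^sub>k\<^sub>j\<close> and \<open>W = X\<^bsub>j,-i\<^esub>\<close>: conjugation by \<open>W\<close> only changes \<open>Q\<close>,
  namely by the factor \<open>r\<close>, which lies in the root subgroup of \<open>X\<^bsub>k,-i\<^esub>\<close>.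
\<close>

lemma comm_comm_swap:
  assumes [simp]: "P \<in> carrier G" "Q \<in> carrier G" "W \<in> carrier G" "r \<in> carrier G"
    and WP: "W \<otimes> P = P \<otimes> W" and WQ: "comm G W Q = r"
    and r: "r \<otimes> comm G P Q = comm G P Q \<otimes> r"
  shows "comm G W (comm G P Q) = comm G P r"
proof -
  have "conjg G W (comm G P Q) = comm G P (r \<otimes> Q)"
    using WP WQ by (simp add: conjg_comm conjg_commuting conjg_eq_comm_mult[of W Q])
  also have "\<dots> = comm G P r \<otimes> comm G P Q"
    using r by (simp add: comm_mult_right conjg_commuting)
  finally show ?thesis
    by (simp add: comm_eq_conjg_mult[of W] m_assoc)
qed

text \<open>
  The expansion of \<open>[X\<^sub>i(u, a), X\<^bsub>-i,j\<^esub>(b)]\<close> for \<open>W = X\<^bsub>-i,j\<^esub>(b)\<close> written as a commutator of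
  \<open>Y = X\<^bsub>-i,-k\<^esub>(b)\<close> and \<open>Z = X\<^bsub>-k,j\<^esub>(1)\<close>.  By (R8), \<open>[S, Y]\<close> has a short factor \<open>p\<close> and a long
  factor \<open>t\<close>; the two elements \<open>r\<close> and \<open>m\<close> of the root subgroup of \<open>X\<^sub>k\<^sub>j\<close> that arise cancel.
\<close>

lemma comm_comm_long:
  assumes [simp]: "S \<in> carrier G" "Y \<in> carrier G" "Z \<in> carrier G" "p \<in> carrier G" "t \<in> carrier G"
      "m \<in> carrier G" "y \<in> carrier G" "q \<in> carrier G" "r \<in> carrier G"
    and SZ: "S \<otimes> Z = Z \<otimes> S" and SY: "comm G S Y = p \<otimes> t"
    and W: "W = comm G Y Z"
    and tW: "t \<otimes> W = W \<otimes> t" and pW: "comm G p W = r"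
    and tZ: "comm G t Z = m \<otimes> y" and pZ: "comm G p Z = q"
    and pm: "p \<otimes> m = m \<otimes> p" and py: "p \<otimes> y = y \<otimes> p"
    and Wm: "W \<otimes> m = m \<otimes> W" and Wy: "W \<otimes> y = y \<otimes> W"
    and rm: "r \<otimes> m = \<one>"
  shows "comm G S W = y \<otimes> conjg G W q"
proof -
  have W_closed [simp]: "W \<in> carrier G" by (simp add: W)
  have "conjg G S W = comm G (p \<otimes> t \<otimes> Y) Z"
    using SZ by (simp add: W conjg_comm conjg_commuting conjg_eq_comm_mult[of S Y] SY)
  also have "\<dots> = conjg G p (conjg G t W) \<otimes> (conjg G p (m \<otimes> y) \<otimes> q)"
    by (simp add: W comm_mult_left mult_conjg tZ pZ)
  also have "conjg G t W = W"
    using tW by (intro conjg_commuting) auto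
  also have "conjg G p W = r \<otimes> W"
    using pW by (simp add: conjg_eq_comm_mult[of p])
  also have "conjg G p (m \<otimes> y) = m \<otimes> y"
    using pm py by (intro conjg_commuting commute_mult) auto
  also have "r \<otimes> W \<otimes> (m \<otimes> y \<otimes> q) = r \<otimes> m \<otimes> (y \<otimes> (W \<otimes> q))"
    by (simp add: m_assoc commute_left[OF Wm] commute_left[OF Wy])
  also have "\<dots> = y \<otimes> (W \<otimes> q)"
    by (simp add: rm)
  finally show ?thesis
    by (simp add: comm_eq_conjg_mult[of S] conjg_def group_word)
qed

text \<open>
  The commutator of the long root elements \<open>S = X\<^sub>i\<close> and \<open>t = X\<^sub>j\<close>, where \<open>t\<close> is written with the help
  of a third index \<open>k\<close> as a short root element \<open>b\<close> times \<open>[T, Z]\<close> for \<open>T = X\<^sub>k\<close>,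
  \<open>Z = X\<^bsub>-k,-j\<^esub>(1)\<close>: conjugation by \<open>S\<close> only affects \<open>T\<close>.
\<close>

lemma comm_long_long:
  assumes [simp]: "S \<in> carrier G" "T \<in> carrier G" "Z \<in> carrier G" "b \<in> carrier G"
      "e \<in> carrier G" "f \<in> carrier G"
    and Sb: "S \<otimes> b = b \<otimes> S" and SZ: "S \<otimes> Z = Z \<otimes> S"
    and ST: "comm G S T = e" and eTZ: "e \<otimes> comm G T Z = comm G T Z \<otimes> e"
    and eZ: "comm G e Z = f" and t: "t = b \<otimes> comm G T Z"
    and ft: "f \<otimes> t = t \<otimes> f"
  shows "comm G S t = f"
proof -
  have "conjg G S (comm G T Z) = comm G (e \<otimes> T) Z"
    using SZ ST by (simp add: conjg_comm conjg_commuting conjg_eq_comm_mult[of S T])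
  also have "\<dots> = comm G T Z \<otimes> f"
    using eTZ eZ by (simp add: comm_mult_left conjg_commuting)
  finally have "conjg G S t = t \<otimes> f"
    using Sb by (simp add: t conjg_mult conjg_commuting m_assoc)
  moreover have "t \<in> carrier G" by (simp add: t)
  ultimately show ?thesis
    by (simp add: comm_eq_conjg_mult m_assoc flip: ft)
qed

text \<open>
  The commutator of \<open>[P, Q]\<close>, a long root element for \<open>i\<close> made of the opposite elements
  \<open>P = X\<^sub>i\<^sub>m\<close> and \<open>Q = X\<^bsub>m,-i\<^esub>\<close>, with \<open>Z = X\<^bsub>-i,-j\<^esub>(1)\<close>.  It produces the opposite elements \<open>p\<close> and
  \<open>q\<close> for \<open>j\<close>, and thereby a long root element for \<open>j\<close>; the factors \<open>x\<close> and \<open>y\<close> lie in the root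
  subgroup of \<open>X\<^bsub>i,-j\<^esub>\<close>, whose elements commute with all the others but \<open>Z\<close>.
\<close>

lemma comm_central_long:
  assumes [simp]: "P \<in> carrier G" "Q \<in> carrier G" "Z \<in> carrier G" "p \<in> carrier G" "q \<in> carrier G"
      "x \<in> carrier G" "y \<in> carrier G"
    and QZ: "comm G Q Z = q" and PZ: "comm G P Z = p"
    and Pq: "comm G P q = x" and Qp: "comm G Q p = inv y"
    and Pp: "P \<otimes> p = p \<otimes> P" and Qq: "Q \<otimes> q = q \<otimes> Q"
    and xP: "x \<otimes> P = P \<otimes> x" and xQ: "x \<otimes> Q = Q \<otimes> x" and xp: "x \<otimes> p = p \<otimes> x" and xq: "x \<otimes> q = q \<otimes> x"
    and yP: "y \<otimes> P = P \<otimes> y" and yp: "y \<otimes> p = p \<otimes> y" and yq: "y \<otimes> q = q \<otimes> y"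
    and cp: "p \<otimes> comm G p q = comm G p q \<otimes> p" and cq: "q \<otimes> comm G p q = comm G p q \<otimes> q"
  shows "comm G (comm G P Q) Z = y \<otimes> x \<otimes> inv (comm G p q)"
proof -
  \<comment> \<open>the inverse conjugation divides by the commutator if that commutes with \<open>g\<close>\<close>
  have undo: "conjg G (inv g) h = inv c \<otimes> h"
    if [simp]: "g \<in> carrier G" "h \<in> carrier G" "c \<in> carrier G"
      and "comm G g h = c" "g \<otimes> c = c \<otimes> g" for g h c
  proof -
    have "inv c \<otimes> h = conjg G (inv g) (conjg G g (inv c \<otimes> h))"
      by (simp flip: mult_conjg) (simp add: conjg_def)
    also have "conjg G g (inv c \<otimes> h) = h"
      using that by (simp add: conjg_mult conjg_inv conjg_commuting conjg_eq_comm_mult[of g h])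
    finally show ?thesis by simp
  qed
  have P': "conjg G (inv P) q = inv x \<otimes> q" "conjg G (inv P) Z = inv p \<otimes> Z"
    and Q': "conjg G (inv Q) Z = inv q \<otimes> Z"
    using assms by (auto intro: undo)
  have Qx: "conjg G Q x = x" "conjg G Q q = q" "conjg G P x = x" "conjg G P p = p" "conjg G P y = y"
    using assms by (auto intro: conjg_commuting)
  have Qs: "conjg G Q p = inv y \<otimes> p" "conjg G Q Z = q \<otimes> Z" "conjg G P q = x \<otimes> q" "conjg G P Z = p \<otimes> Z"
    using assms by (simp_all add: conjg_eq_comm_mult)
  have "conjg G (comm G P Q) Z = conjg G P (conjg G Q (conjg G (inv P) (conjg G (inv Q) Z)))"
    by (simp add: comm_def mult_conjg)
  also have "\<dots> = inv q \<otimes> (inv p \<otimes> (y \<otimes> (x \<otimes> (q \<otimes> (p \<otimes> Z)))))"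
    by (simp add: P' Q' Qx Qs conjg_mult conjg_inv group_word)
  also have "y \<otimes> (x \<otimes> (q \<otimes> (p \<otimes> Z))) = q \<otimes> (p \<otimes> (y \<otimes> (x \<otimes> Z)))"
    by (simp add: commute_left[OF xq] commute_left[OF xp] commute_left[OF yq] commute_left[OF yp])
  also have "inv q \<otimes> (inv p \<otimes> (q \<otimes> (p \<otimes> (y \<otimes> (x \<otimes> Z))))) = comm G (inv q) (inv p) \<otimes> (y \<otimes> (x \<otimes> Z))"
    by (simp add: comm_def group_word)
  also have "comm G (inv q) (inv p) = inv (comm G p q)"
  proof -
    have pq: "comm G q (inv p) = comm G p q"
      using comm_inv_right[of q p] cp commute_inv[of p "comm G p q"] by (simp add: comm_inverse)
    then show ?thesis
      using comm_inv_left[of q "inv p"] cq by simp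
  qed
  also have "inv (comm G p q) \<otimes> (y \<otimes> (x \<otimes> Z)) = y \<otimes> (x \<otimes> (inv (comm G p q) \<otimes> Z))"
    using commute_left[OF commute_inv[OF _ _ commute_comm[OF _ _ _ xp xq]], of Z]
      commute_left[OF commute_inv[OF _ _ commute_comm[OF _ _ _ yp yq]], of "x \<otimes> Z"]
    by simp
  finally show ?thesis
    by (simp add: comm_eq_conjg_mult[of _ Z] m_assoc)
qed

end

lemma hom_comm:
  assumes "group G" "group H" "h \<in> hom G H" "x \<in> carrier G" "y \<in> carrier G"
  shows "h (comm G x y) = comm H (h x) (h y)"
proof -
  interpret group_hom G H h
    using assms by (intro group_hom.intro group_hom_axioms.intro)
  show ?thesis
    using assms(4,5) by (simp add: comm_def)
qed


section \<open>Odd quadratic spaces\<close>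

context pseudo_involution
begin

abbreviation bar_inv :: 'r where
  "bar_inv \<equiv> ring_inverse (bar 1)"

lemma bar_inv [simp]: "bar 1 * bar_inv = 1" "bar_inv * bar 1 = 1"
proof -
  have "bar 1 * bar_inv = 1 \<and> bar_inv * bar 1 = 1"
    unfolding ring_inverse_def
  proof (rule theI')
    from bar_one_invertible obtain y where y: "bar 1 * y = 1" "y * bar 1 = 1"
      by blast
    moreover have "z = y" if "bar 1 * z = 1" for z
      using y that by (metis mult.assoc mult_1_left mult_1_right)
    ultimately show "\<exists>!y. bar 1 * y = 1 \<and> y * bar 1 = 1"
      by blast
  qed
  then show "bar 1 * bar_inv = 1" "bar_inv * bar 1 = 1" by auto
qed

lemma bar_inv_cancel [simp]: "bar 1 * (bar_inv * x) = x" "bar_inv * (bar 1 * x) = x"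
  by (simp_all flip: mult.assoc)

lemma bar_zero [simp]: "bar 0 = 0"
  using bar_add[of 0 0] by simp

lemma bar_minus: "bar (- a) = - bar a"
  using bar_add[of a "- a"] minus_unique[of "bar a" "bar (- a)"] by simp

lemma bar_bar_inv: "bar bar_inv = bar 1 * bar 1"
proof -
  have "bar bar_inv * bar_inv * bar (bar 1) = bar 1"
    by (simp only: bar_mult[symmetric] bar_inv)
  then have "bar bar_inv * bar_inv * bar 1 = bar 1 * bar 1"
    by (simp only: bar_bar mult_1_right)
  then show ?thesis
    by (simp add: mult.assoc)
qed

lemmas bar_simps = bar_add bar_minus bar_mult bar_bar bar_bar_inv mult.assoc

end

context odd_quadratic_space
begin

lemma bar_form: "bar (B u v) = - B v u"
  using form_anti[of v u] by (simp add: bar_minus)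

lemma form_zero [simp]: "B u 0 = 0" "B 0 v = 0"
  using form_add_right[of u 0 0] form_add_left[of 0 0 v] by simp_all

text \<open>
  When (R0) is applied to a short root element whose parameter has the form \<open>eps i * x\<close>, the two
  coefficients for \<open>i\<close> cancel.
\<close>

lemma bar_eps: "bar (eps i * x) * eps i = bar x"
  by (simp add: eps_def bar_simps)

lemma eps_eps_minus: "i \<noteq> 0 \<Longrightarrow> eps i * eps (- i) = - bar_inv"
  by (auto simp: eps_def)

lemma eps_bar_one_eps_minus: "i \<noteq> 0 \<Longrightarrow> eps i * (bar 1 * (eps (- i) * x)) = - x"
  by (auto simp: eps_def)

lemma L_mult: "\<lbrakk>(u, a) \<in> L; (v, b) \<in> L\<rbrakk> \<Longrightarrow> (u + v, a + b + B u v) \<in> L"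
  using subgroup.m_closed[OF L_subgroup, of "(u, a)" "(v, b)"] by (simp add: heisenberg_def)

lemma L_min: "(0, a + bar a) \<in> L"
  using L_min_subset by (auto simp: L_min_def)

lemma L_opposite:
  assumes "i \<noteq> 0"
  shows "(0, - (eps (- i) * bar 1 * a * b) + bar b * bar_inv * bar a * eps i) \<in> L"
proof -
  have "bar (- (eps (- i) * bar 1 * a * b)) = bar b * bar_inv * bar a * eps i"
    using assms by (auto simp: eps_def bar_simps)
  then show ?thesis
    using L_min[of "- (eps (- i) * bar 1 * a * b)"] by simp
qed

lemma L_form: "(0, B u v - B v u) \<in> L"
  using L_min[of "B u v"] by (simp add: bar_form)

text \<open>
  The parameters of the two long root elements in (R8) with \<open>b = 1\<close> are \<open>(u, a)\<close> and
  \<open>(u, - bar a)\<close>, and \<open>a \<mapsto> - bar a\<close> is an involution.  This is why a long root element for one index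
  can be recovered from one for another index.
\<close>

lemma L_dual: "(u, a) \<in> L \<Longrightarrow> (u, - bar a) \<in> L"
  using L_mult[OF _ L_min[of "- a"], of u a] by (simp add: bar_minus)

lemma heis_act_L: "(u, a) \<in> L \<Longrightarrow> (act u b, bar b * bar_inv * a * b) \<in> L"
  using L_act[of "(u, a)" b] by (simp add: heis_act_def)

end


section \<open>Steinberg families\<close>

text \<open>
  The condition \<open>i \<noteq> \<plusminus>j\<close>, as a symmetric predicate that is invariant under the change of signs.
\<close>

definition apart :: "int \<Rightarrow> int \<Rightarrow> bool" where
  "apart i j \<longleftrightarrow> i \<notin> {j, - j}"

lemma apart_cong: "\<lbrakk>\<not> apart l j; apart m j\<rbrakk> \<Longrightarrow> apart m l"
  by (auto simp: apart_def)

lemma apart_commute: "apart i j \<longleftrightarrow> apart j i"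
  by (auto simp: apart_def)

lemma apart_simps:
  "apart (- i) j \<longleftrightarrow> apart i j" "apart i (- j) \<longleftrightarrow> apart i j"
  "apart i j \<Longrightarrow> i \<noteq> j" "apart i j \<Longrightarrow> i \<noteq> - j" "apart i j \<Longrightarrow> - i \<noteq> j"
  by (auto simp: apart_def)

declare apart_commute [simp] apart_simps [simp]

text \<open>
  A Steinberg family over a set \<open>\<Omega>\<close> of indices in a group is a system of elements that
  satisfies the relations of the odd unitary Steinberg group.  Admitting every symmetric \<open>\<Omega>\<close>
  treats the groups of finite and of infinite rank at once.
\<close>

locale steinberg_family = odd_quadratic_space bar act B L + group G
  for bar :: "'r::{ring, monoid_mult} \<Rightarrow> 'r"
    and act :: "'v::ab_group_add \<Rightarrow> 'r \<Rightarrow> 'v"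
    and B :: "'v \<Rightarrow> 'v \<Rightarrow> 'r"
    and L :: "('v \<times> 'r) set"
    and G :: "('g, 'm) monoid_scheme" (structure) +
  fixes \<Omega> :: "int set"
    and xs :: "int \<Rightarrow> int \<Rightarrow> 'r \<Rightarrow> 'g"
    and xl :: "int \<Rightarrow> 'v \<times> 'r \<Rightarrow> 'g"
  assumes Omega_nonzero: "0 \<notin> \<Omega>"
    and Omega_minus: "i \<in> \<Omega> \<Longrightarrow> - i \<in> \<Omega>"
    and xs_closed: "\<lbrakk>i \<in> \<Omega>; j \<in> \<Omega>; apart i j\<rbrakk> \<Longrightarrow> xs i j a \<in> carrier G"
    and xl_closed: "\<lbrakk>i \<in> \<Omega>; \<xi> \<in> L\<rbrakk> \<Longrightarrow> xl i \<xi> \<in> carrier G"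
    and R0: "\<lbrakk>i \<in> \<Omega>; j \<in> \<Omega>; apart i j\<rbrakk>
      \<Longrightarrow> xs i j a = xs (- j) (- i) (eps (- j) * bar a * eps i)"
    and R1: "\<lbrakk>i \<in> \<Omega>; j \<in> \<Omega>; apart i j\<rbrakk> \<Longrightarrow> xs i j a \<otimes> xs i j b = xs i j (a + b)"
    and R2: "\<lbrakk>i \<in> \<Omega>; (u, a) \<in> L; (v, b) \<in> L\<rbrakk>
      \<Longrightarrow> xl i (u, a) \<otimes> xl i (v, b) = xl i (u + v, a + b + B u v)"
    and R3: "\<lbrakk>i \<in> \<Omega>; j \<in> \<Omega>; apart i j; h \<in> \<Omega>; k \<in> \<Omega>; apart h k;
        h \<noteq> j; h \<noteq> - i; k \<noteq> i; k \<noteq> - j\<rbrakk>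
      \<Longrightarrow> xs i j a \<otimes> xs h k b = xs h k b \<otimes> xs i j a"
    and R4: "\<lbrakk>i \<in> \<Omega>; \<xi> \<in> L; j \<in> \<Omega>; k \<in> \<Omega>; apart j k; j \<noteq> - i; k \<noteq> i\<rbrakk>
      \<Longrightarrow> xl i \<xi> \<otimes> xs j k a = xs j k a \<otimes> xl i \<xi>"
    and R5: "\<lbrakk>i \<in> \<Omega>; j \<in> \<Omega>; k \<in> \<Omega>; apart i j; apart j k; apart i k\<rbrakk>
      \<Longrightarrow> comm G (xs i j a) (xs j k b) = xs i k (a * b)"
    and R6: "\<lbrakk>i \<in> \<Omega>; j \<in> \<Omega>; apart i j; (u, a) \<in> L; (v, b) \<in> L\<rbrakk>
      \<Longrightarrow> comm G (xl i (u, a)) (xl j (v, b)) = xs i (- j) (eps i * B u v)"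
    and R7: "\<lbrakk>i \<in> \<Omega>; (u, a) \<in> L; (v, b) \<in> L\<rbrakk>
      \<Longrightarrow> comm G (xl i (u, a)) (xl i (v, b)) = xl i (0, B u v - B v u)"
    and R8: "\<lbrakk>i \<in> \<Omega>; j \<in> \<Omega>; apart i j; (u, a) \<in> L\<rbrakk>
      \<Longrightarrow> comm G (xl i (u, a)) (xs (- i) j b)
            = xs i j (eps i * a * b) \<otimes> xl (- j) (heis_act (u, - bar a) b)"
    and R9: "\<lbrakk>i \<in> \<Omega>; j \<in> \<Omega>; apart i j\<rbrakk>
      \<Longrightarrow> comm G (xs i j a) (xs j (- i) b)
            = xl i (0, - eps (- i) * bar 1 * a * b + bar b * bar_inv * bar a * eps i)"


context steinberg_family
begin

lemma Omega_simps [simp]: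
  "0 \<notin> \<Omega>" "i \<in> \<Omega> \<Longrightarrow> i \<noteq> 0" "- i \<in> \<Omega> \<longleftrightarrow> i \<in> \<Omega>"
  using Omega_nonzero Omega_minus[of i] Omega_minus[of "- i"] by auto

abbreviation short :: "int \<Rightarrow> int \<Rightarrow> bool" where
  "short i j \<equiv> i \<in> \<Omega> \<and> j \<in> \<Omega> \<and> apart i j"

lemma xs_zero:
  assumes "short i j"
  shows "xs i j 0 = \<one>"
  using R1[of i j 0 0] assms xs_closed[of i j 0] by simp

lemma xs_cancel:
  assumes "short i j" "x \<in> carrier G"
  shows "xs i j a \<otimes> (xs i j (- a) \<otimes> x) = x"
  using assms R1[of i j a "- a"] by (simp add: xs_closed xs_zero flip: m_assoc)

text \<open>
  Relation (R8) with \<open>b = 1\<close>, solved for the long root element.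
\<close>

lemma long_from_short:
  assumes "short k j" "(u, a) \<in> L"
  shows "xl j (u, a) = xs k (- j) (eps k * bar a) \<otimes> comm G (xl k (u, - bar a)) (xs (- k) (- j) 1)"
proof -
  have "comm G (xl k (u, - bar a)) (xs (- k) (- j) 1) = xs k (- j) (- (eps k * bar a)) \<otimes> xl j (u, a)"
    using R8[of k "- j" u "- bar a" 1] assms L_dual[of u a]
    by (simp add: bar_minus bar_bar heis_act_def act_one)
  then show ?thesis
    using assms by (simp add: xs_cancel xl_closed)
qed

definition generators :: "'g set" where
  "generators = {xs i j a | i j a. i \<in> \<Omega> \<and> j \<in> \<Omega> \<and> apart i j} \<union> {xl i \<xi> | i \<xi>. i \<in> \<Omega> \<and> \<xi> \<in> L}"

lemma generators_closed: "generators \<subseteq> carrier G"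
  by (auto simp: generators_def xs_closed xl_closed)

text \<open>
  The pointwise assumptions leave the values at indices outside \<open>\<Omega>\<close> free; in the direct limit,
  one family on all indices restricts to the image of a different family at each stage.
\<close>

lemma family_image:
  assumes K: "group K" and h: "h \<in> hom G K"
    and ys: "\<And>i j a. \<lbrakk>i \<in> \<Omega>; j \<in> \<Omega>; apart i j\<rbrakk> \<Longrightarrow> ys i j a = h (xs i j a)"
    and yl: "\<And>i \<xi>. \<lbrakk>i \<in> \<Omega>; \<xi> \<in> L\<rbrakk> \<Longrightarrow> yl i \<xi> = h (xl i \<xi>)"
  shows "steinberg_family bar act B L K \<Omega> ys yl"
proof -
  interpret K: group K by (rule K)
  have comm: "comm K (h x) (h y) = h (comm G x y)" if "x \<in> carrier G" "y \<in> carrier G" for x y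
    using hom_comm[OF is_group K h that] by simp
  have mult: "h x \<otimes>\<^bsub>K\<^esub> h y = h (x \<otimes> y)" if "x \<in> carrier G" "y \<in> carrier G" for x y
    using Group.hom_mult[OF h that] by simp
  have closed: "h x \<in> carrier K" if "x \<in> carrier G" for x
    using h that by (auto simp: hom_def)
  note simps = ys yl comm mult closed xs_closed xl_closed
  show ?thesis
  proof unfold_locales
    fix i j :: int and a b
    assume ij: "i \<in> \<Omega>" "j \<in> \<Omega>" "apart i j"
    show "ys i j a \<in> carrier K" "ys i j a \<otimes>\<^bsub>K\<^esub> ys i j b = ys i j (a + b)"
      using ij R1[of i j a b] by (simp_all add: simps)
    show "ys i j a = ys (- j) (- i) (eps (- j) * bar a * eps i)"
      using ij R0[of i j a] by (simp add: simps)
    show "comm K (ys i j a) (ys j (- i) b)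
      = yl i (0, - eps (- i) * bar 1 * a * b + bar b * bar_inv * bar a * eps i)"
      using ij R9[of i j a b] L_opposite[of i a b] by (simp add: simps)
  next
    fix i \<xi>
    assume "i \<in> \<Omega>" "\<xi> \<in> L"
    then show "yl i \<xi> \<in> carrier K"
      by (simp add: simps)
  next
    fix i u a v b
    assume i: "i \<in> \<Omega>" "(u, a) \<in> L" "(v, b) \<in> L"
    then show "yl i (u, a) \<otimes>\<^bsub>K\<^esub> yl i (v, b) = yl i (u + v, a + b + B u v)"
      using R2[of i u a v b] L_mult[of u a v b] by (simp add: simps)
    show "comm K (yl i (u, a)) (yl i (v, b)) = yl i (0, B u v - B v u)"
      using i R7[of i u a v b] L_form[of u v] by (simp add: simps)
  next
    fix i j h' k :: int and a b
    assume "i \<in> \<Omega>" "j \<in> \<Omega>" "apart i j" "h' \<in> \<Omega>" "k \<in> \<Omega>" "apart h' k"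
      "h' \<noteq> j" "h' \<noteq> - i" "k \<noteq> i" "k \<noteq> - j"
    then show "ys i j a \<otimes>\<^bsub>K\<^esub> ys h' k b = ys h' k b \<otimes>\<^bsub>K\<^esub> ys i j a"
      using R3[of i j h' k a b] by (simp add: simps)
  next
    fix i \<xi> j k a
    assume "i \<in> \<Omega>" "\<xi> \<in> L" "j \<in> \<Omega>" "k \<in> \<Omega>" "apart j k" "j \<noteq> - i" "k \<noteq> i"
    then show "yl i \<xi> \<otimes>\<^bsub>K\<^esub> ys j k a = ys j k a \<otimes>\<^bsub>K\<^esub> yl i \<xi>"
      using R4[of i \<xi> j k a] by (simp add: simps)
  next
    fix i j k a b
    assume "i \<in> \<Omega>" "j \<in> \<Omega>" "k \<in> \<Omega>" "apart i j" "apart j k" "apart i k"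
    then show "comm K (ys i j a) (ys j k b) = ys i k (a * b)"
      using R5[of i j k a b] by (simp add: simps)
  next
    fix i j u a v b
    assume "i \<in> \<Omega>" "j \<in> \<Omega>" "apart i j" "(u, a) \<in> L" "(v, b) \<in> L"
    then show "comm K (yl i (u, a)) (yl j (v, b)) = ys i (- j) (eps i * B u v)"
      using R6[of i j u a v b] by (simp add: simps)
  next
    fix i j u a b
    assume "i \<in> \<Omega>" "j \<in> \<Omega>" "apart i j" "(u, a) \<in> L"
    then show "comm K (yl i (u, a)) (ys (- i) j b)
        = ys i j (eps i * a * b) \<otimes>\<^bsub>K\<^esub> yl (- j) (heis_act (u, - bar a) b)"
      using R8[of i j u a b] L_act[OF L_dual, of u a b] by (simp add: simps)
  qed auto
qed

lemma family_subset:
  assumes "\<Omega>' \<subseteq> \<Omega>" "\<And>i. i \<in> \<Omega>' \<Longrightarrow> - i \<in> \<Omega>'"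
  shows "steinberg_family bar act B L G \<Omega>' xs xl"
proof -
  have sub: "i \<in> \<Omega>" if "i \<in> \<Omega>'" for i
    using that assms(1) by blast
  show ?thesis
    by (unfold_locales; (rule xs_closed xl_closed R0 R1 R2 R3 R4 R5 R6 R7 R8 R9)?;
        (use assms(2) sub Omega_nonzero in blast))
qed

end


section \<open>Lifts to a central extension\<close>

locale central_ext = group H + cod: group G
  for H :: "('h, 'k) monoid_scheme" (structure) and G :: "('g, 'm) monoid_scheme" +
  fixes \<pi> :: "'h \<Rightarrow> 'g"
  assumes hom: "\<pi> \<in> hom H G"
    and surj: "\<pi> ` carrier H = carrier G"
    and central: "\<lbrakk>z \<in> kernel H G \<pi>; x \<in> carrier H\<rbrakk> \<Longrightarrow> z \<otimes> x = x \<otimes> z"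
begin

sublocale group_hom H G \<pi>
  using hom by unfold_locales

definition lift :: "'g \<Rightarrow> 'h \<Rightarrow> bool" where
  "lift g x \<longleftrightarrow> x \<in> carrier H \<and> \<pi> x = g"

definition some_lift :: "'g \<Rightarrow> 'h" where
  "some_lift g = (SOME x. lift g x)"

lemma lift_closed: "lift g x \<Longrightarrow> x \<in> carrier H"
  by (simp add: lift_def)

lemma some_lift: "g \<in> carrier G \<Longrightarrow> lift g (some_lift g)"
  unfolding some_lift_def by (rule someI_ex) (auto simp: lift_def simp flip: surj)

lemma lift_mult: "\<lbrakk>lift g x; lift h y\<rbrakk> \<Longrightarrow> lift (g \<otimes>\<^bsub>G\<^esub> h) (x \<otimes> y)"
  by (auto simp: lift_def)

lemma lift_comm: "\<lbrakk>lift g x; lift h y\<rbrakk> \<Longrightarrow> lift (comm G g h) (comm H x y)"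
  by (auto simp: lift_def comm_def)

lemma lift_same:
  assumes "lift g x" "lift g y"
  obtains z where "z \<in> carrier H" "x = z \<otimes> y" "\<And>w. w \<in> carrier H \<Longrightarrow> z \<otimes> w = w \<otimes> z"
proof
  have "x \<otimes> inv y \<in> kernel H G \<pi>"
    using assms by (auto simp: lift_def kernel_def)
  with central show "\<And>w. w \<in> carrier H \<Longrightarrow> x \<otimes> inv y \<otimes> w = w \<otimes> (x \<otimes> inv y)"
    by blast
qed (use assms in \<open>auto simp: lift_def m_assoc\<close>)

lemma comm_lift_unique:
  assumes "lift g x" "lift g x'" "lift h y" "lift h y'"
  shows "comm H x y = comm H x' y'"
proof -
  note [simp] = assms[THEN lift_closed]
  obtain z where z: "z \<in> carrier H" "x = z \<otimes> x'" "\<And>w. w \<in> carrier H \<Longrightarrow> z \<otimes> w = w \<otimes> z"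
    using assms by (meson lift_same)
  obtain z' where z': "z' \<in> carrier H" "y = z' \<otimes> y'" "\<And>w. w \<in> carrier H \<Longrightarrow> z' \<otimes> w = w \<otimes> z'"
    using assms by (meson lift_same)
  have "comm H x y = comm H x' y"
    using z by (simp add: comm_mult_left conjg_commuting comm_one_iff[THEN iffD2])
  also have "\<dots> = comm H x' y'"
    using z' by (simp add: comm_mult_right conjg_commuting comm_one_iff[THEN iffD2])
  finally show ?thesis .
qed

lemma lift_commute_iff:
  assumes "lift g x" "lift g x'" "lift h y" "lift h y'"
  shows "x \<otimes> y = y \<otimes> x \<longleftrightarrow> x' \<otimes> y' = y' \<otimes> x'"
  using comm_lift_unique[OF assms] assms[THEN lift_closed] by (simp flip: comm_one_iff)

text \<open>
  An element commuting with \<open>y\<close> and \<open>z\<close> up to the central kernel commutes exactly with their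
  commutator, since a commutator does not change when its entries are multiplied by central
  elements.
\<close>

lemma lift_commute_comm:
  assumes x: "lift g x" and y: "lift h y" and z: "lift k z" and t: "lift (comm G h k) t"
    and "g \<otimes>\<^bsub>G\<^esub> h = h \<otimes>\<^bsub>G\<^esub> g" "g \<otimes>\<^bsub>G\<^esub> k = k \<otimes>\<^bsub>G\<^esub> g"
  shows "x \<otimes> t = t \<otimes> x"
proof -
  note [simp] = x[THEN lift_closed] y[THEN lift_closed] z[THEN lift_closed]
  have G: "g \<in> carrier G" "h \<in> carrier G" "k \<in> carrier G"
    using x y z by (auto simp: lift_def)
  have conj: "lift l (conjg H x w)" if "lift l w" "g \<otimes>\<^bsub>G\<^esub> l = l \<otimes>\<^bsub>G\<^esub> g" for l w
    using that x cod.conjg_commuting[of g l] by (auto simp: lift_def conjg_def)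
  have "conjg H x (comm H y z) = comm H y z"
    using comm_lift_unique[OF conj[OF y] y conj[OF z] z] assms by (simp add: conjg_comm)
  then have "comm H x (comm H y z) = \<one>"
    by (simp add: comm_eq_conjg_mult)
  then have "x \<otimes> comm H y z = comm H y z \<otimes> x"
    by (simp add: comm_one_iff)
  then show ?thesis
    using lift_commute_iff[OF x x t lift_comm[OF y z]] by simp
qed

end


section \<open>Lifts of the short root elements\<close>

locale steinberg_extension =
  odd_quadratic_space bar act B L + central_ext H G \<pi> +
  st: steinberg_family bar act B L G \<Omega> xs xl
  for bar :: "'r::{ring, monoid_mult} \<Rightarrow> 'r"
    and act :: "'v::ab_group_add \<Rightarrow> 'r \<Rightarrow> 'v"
    and B :: "'v \<Rightarrow> 'v \<Rightarrow> 'r"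
    and L :: "('v \<times> 'r) set"
    and H :: "('h, 'k) monoid_scheme" (structure)
    and G :: "('g, 'm) monoid_scheme"
    and \<pi> :: "'h \<Rightarrow> 'g"
    and \<Omega> :: "int set"
    and xs :: "int \<Rightarrow> int \<Rightarrow> 'r \<Rightarrow> 'g"
    and xl :: "int \<Rightarrow> 'v \<times> 'r \<Rightarrow> 'g" +
  assumes five_indices: "{1..5} \<subseteq> \<Omega>"
begin

abbreviation "short \<equiv> st.short"

lemma fresh_index:
  obtains l where "l \<in> \<Omega>" "apart l i" "apart l j" "apart l h" "apart l k"
proof -
  have "card {\<bar>i\<bar>, \<bar>j\<bar>, \<bar>h\<bar>, \<bar>k\<bar>} \<le> 4"
    by (simp add: card_insert_if)
  then have "\<not> {1..5} \<subseteq> {\<bar>i\<bar>, \<bar>j\<bar>, \<bar>h\<bar>, \<bar>k\<bar>}"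
    using card_mono[of "{\<bar>i\<bar>, \<bar>j\<bar>, \<bar>h\<bar>, \<bar>k\<bar>}" "{1..5::int}"] by auto
  then obtain l where l: "l \<in> {1..5}" "l \<notin> {\<bar>i\<bar>, \<bar>j\<bar>, \<bar>h\<bar>, \<bar>k\<bar>}"
    by blast
  then have "apart l m" if "l \<noteq> \<bar>m\<bar>" for m
    using that unfolding apart_def by auto
  with l five_indices that show thesis
    by auto
qed

abbreviation xs_lift :: "int \<Rightarrow> int \<Rightarrow> 'r \<Rightarrow> 'h" where
  "xs_lift i j a \<equiv> some_lift (xs i j a)"

abbreviation xl_lift :: "int \<Rightarrow> 'v \<times> 'r \<Rightarrow> 'h" where
  "xl_lift i \<xi> \<equiv> some_lift (xl i \<xi>)"

lemma xs_lift: "short i j \<Longrightarrow> lift (xs i j a) (xs_lift i j a)"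
  by (simp add: some_lift st.xs_closed)

lemma xl_lift: "\<lbrakk>i \<in> \<Omega>; \<xi> \<in> L\<rbrakk> \<Longrightarrow> lift (xl i \<xi>) (xl_lift i \<xi>)"
  by (simp add: some_lift st.xl_closed)

text \<open>
  The second element is factored through an index \<open>l\<close> that differs from \<open>i, j, h, k\<close> up to sign, so
  that (R3) makes both factors commute with the first element in \<open>G\<close>.  These four indices may all be
  different up to sign, and then a fifth one is needed.
\<close>

lemma lifts_commute_short_short:
  assumes "short i j" "short h k" "h \<noteq> j" "h \<noteq> - i" "k \<noteq> i" "k \<noteq> - j"
    and x: "lift (xs i j a) x" and y: "lift (xs h k b) y"
  shows "x \<otimes> y = y \<otimes> x"
proof -
  obtain l where l: "l \<in> \<Omega>" "apart l i" "apart l j" "apart l h" "apart l k"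
    by (rule fresh_index)
  have hk: "lift (comm G (xs h l b) (xs l k 1)) y"
    using y st.R5[of h l k b 1] l assms(1,2) by simp
  have "xs i j a \<otimes>\<^bsub>G\<^esub> xs h l b = xs h l b \<otimes>\<^bsub>G\<^esub> xs i j a"
    by (rule st.R3) (use l assms in auto)
  moreover have "xs i j a \<otimes>\<^bsub>G\<^esub> xs l k 1 = xs l k 1 \<otimes>\<^bsub>G\<^esub> xs i j a"
    by (rule st.R3) (use l assms in auto)
  ultimately show ?thesis
    by (rule lift_commute_comm[OF x xs_lift xs_lift hk, rotated 2]) (use l assms(1,2) in auto)
qed

lemma lifts_commute_long_short:
  assumes "i \<in> \<Omega>" "\<xi> \<in> L" "short j k" "j \<noteq> - i" "k \<noteq> i"
    and x: "lift (xl i \<xi>) x" and y: "lift (xs j k b) y"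
  shows "x \<otimes> y = y \<otimes> x"
proof -
  obtain l where l: "l \<in> \<Omega>" "apart l i" "apart l j" "apart l k"
    by (rule fresh_index)
  have jk: "lift (comm G (xs j l b) (xs l k 1)) y"
    using y st.R5[of j l k b 1] l assms(3) by simp
  have "xl i \<xi> \<otimes>\<^bsub>G\<^esub> xs j l b = xs j l b \<otimes>\<^bsub>G\<^esub> xl i \<xi>"
    by (rule st.R4) (use l assms in auto)
  moreover have "xl i \<xi> \<otimes>\<^bsub>G\<^esub> xs l k 1 = xs l k 1 \<otimes>\<^bsub>G\<^esub> xl i \<xi>"
    by (rule st.R4) (use l assms in auto)
  ultimately show ?thesis
    by (rule lift_commute_comm[OF x xs_lift xs_lift jk, rotated 2]) (use l assms(3) in auto)
qed

text \<open>
  The lift of \<open>X\<^sub>i\<^sub>j(a)\<close>; by \<open>comm_short_short\<close> below, \<open>l\<close> may be any index apart from \<open>i\<close> and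
  \<open>j\<close>.
\<close>

definition ys :: "int \<Rightarrow> int \<Rightarrow> 'r \<Rightarrow> 'h" where
  "ys i j a = (let l = SOME l. l \<in> \<Omega> \<and> apart l i \<and> apart l j
     in comm H (xs_lift i l a) (xs_lift l j 1))"

text \<open>
  Write \<open>X\<^sub>l\<^sub>j(b)\<close> as \<open>[X\<^sub>l\<^sub>m(b), X\<^sub>m\<^sub>j(1)]\<close> and shift the bracket; all lifts that have to commute for
  this do so by (R3).
\<close>

lemma comm_change_middle:
  assumes ij: "short i j" and l: "l \<in> \<Omega>" "apart l i" "apart l j"
    and m: "m \<in> \<Omega>" "apart m i" "apart m j" "apart m l"
    and x: "lift (xs i l a) x" and y: "lift (xs l j b) y"
  shows "comm H x y = comm H (xs_lift i m (a * b)) (xs_lift m j 1)"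
proof -
  let ?y = "xs_lift l m b" and ?z = "xs_lift m j 1"
  have y': "lift (xs l m b) ?y" and z': "lift (xs m j 1) ?z"
    using xs_lift l m ij by auto
  note [simp] = x[THEN lift_closed] y'[THEN lift_closed] z'[THEN lift_closed]
  have yz: "lift (xs l j b) (comm H ?y ?z)"
    using lift_comm[OF y' z'] st.R5[of l m j b 1] l m ij by auto
  have xy: "lift (xs i m (a * b)) (comm H x ?y)"
    using lift_comm[OF x y'] st.R5[of i l m a b] l m ij by auto
  have xyz: "lift (xs i j (a * b)) (comm H (comm H x ?y) ?z)"
    using lift_comm[OF xy z'] st.R5[of i m j "a * b" 1] m ij by auto
  have "comm H x y = comm H x (comm H ?y ?z)"
    using x y yz by (blast intro: comm_lift_unique)
  also have "\<dots> = comm H (comm H x ?y) ?z"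
  proof (rule comm_comm_eq)
    show "x \<otimes> ?z = ?z \<otimes> x"
      by (rule lifts_commute_short_short[OF _ _ _ _ _ _ x z']) (use l m ij in auto)
    show "comm H x ?y \<otimes> comm H ?y ?z = comm H ?y ?z \<otimes> comm H x ?y"
      by (rule lifts_commute_short_short[OF _ _ _ _ _ _ xy yz]) (use l m ij in auto)
    show "comm H ?y ?z \<otimes> comm H (comm H x ?y) ?z = comm H (comm H x ?y) ?z \<otimes> comm H ?y ?z"
      by (rule lifts_commute_short_short[OF _ _ _ _ _ _ yz xyz]) (use l m ij in auto)
  qed auto
  also have "\<dots> = comm H (xs_lift i m (a * b)) ?z"
    by (rule comm_lift_unique[OF xy xs_lift z' z']) (use m ij in auto)
  finally show ?thesis .
qed

lemma comm_short_short:
  assumes "i \<in> \<Omega>" "j \<in> \<Omega>" "k \<in> \<Omega>" "apart i j" "apart j k" "apart i k"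
    and x: "lift (xs i j a) x" and y: "lift (xs j k b) y"
  shows "comm H x y = ys i k (a * b)"
proof -
  define P where "P l \<longleftrightarrow> l \<in> \<Omega> \<and> apart l i \<and> apart l k" for l
  define l where "l = (SOME l. P l)"
  have "P j"
    using assms(1-6) by (simp add: P_def)
  then have "P l"
    unfolding l_def by (rule someI)
  then have l: "l \<in> \<Omega>" "apart l i" "apart l k"
    by (auto simp: P_def)
  have ys: "ys i k (a * b) = comm H (xs_lift i l (a * b)) (xs_lift l k 1)"
    by (simp add: ys_def Let_def l_def P_def)
  show ?thesis
  proof (cases "apart l j")
    case True
    show ?thesis
      unfolding ys by (rule comm_change_middle[OF _ _ _ _ _ _ _ _ x y]) (use True assms(1-6) l in auto)
  next
    case False
    \<comment> \<open>\<open>comm_change_middle\<close> relates only indices apart from each other, hence the detour through \<open>m\<close>\<close>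
    obtain m where m: "m \<in> \<Omega>" "apart m i" "apart m j" "apart m k"
      by (rule fresh_index)
    have "comm H x y = comm H (xs_lift i m (a * b)) (xs_lift m k 1)"
      by (rule comm_change_middle[OF _ _ _ _ _ _ _ _ x y]) (use assms(1-6) m in auto)
    also have "\<dots> = comm H (xs_lift i l (a * b * 1)) (xs_lift l k 1)"
      by (rule comm_change_middle[OF _ _ _ _ _ _ _ _ xs_lift xs_lift]) (use assms(1-6) m l apart_cong[OF False m(3)] in auto)
    finally show ?thesis
      using ys by simp
  qed
qed

lemma ys_lift:
  assumes "short i j"
  shows "lift (xs i j a) (ys i j a)"
proof -
  obtain l where l: "l \<in> \<Omega>" "apart l i" "apart l j"
    by (rule fresh_index)
  have "comm H (xs_lift i l a) (xs_lift l j 1) = ys i j (a * 1)"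
    by (rule comm_short_short[OF _ _ _ _ _ _ xs_lift xs_lift]) (use l assms in auto)
  then show ?thesis
    using lift_comm[OF xs_lift[of i l a] xs_lift[of l j 1]] st.R5[of i l j a 1] l assms by auto
qed

lemma ys_closed [simp]: "short i j \<Longrightarrow> ys i j a \<in> carrier H"
  using ys_lift lift_closed by blast

lemma ys_R5:
  assumes "i \<in> \<Omega>" "j \<in> \<Omega>" "k \<in> \<Omega>" "apart i j" "apart j k" "apart i k"
  shows "comm H (ys i j a) (ys j k b) = ys i k (a * b)"
  by (rule comm_short_short[OF assms ys_lift ys_lift]) (use assms in auto)

lemma ys_R3:
  assumes "short i j" "short h k" "h \<noteq> j" "h \<noteq> - i" "k \<noteq> i" "k \<noteq> - j"
  shows "ys i j a \<otimes> ys h k b = ys h k b \<otimes> ys i j a"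
  by (rule lifts_commute_short_short[OF assms ys_lift ys_lift]) (use assms in auto)

lemma ys_R1:
  assumes ij: "short i j"
  shows "ys i j a \<otimes> ys i j b = ys i j (a + b)"
proof -
  obtain l where l: "l \<in> \<Omega>" "apart l i" "apart l j"
    by (rule fresh_index)
  have il: "short i l" and lj: "short l j"
    using l ij by auto
  have sum: "lift (xs i l (a + b)) (ys i l a \<otimes> ys i l b)"
    using lift_mult[OF ys_lift[OF il] ys_lift[OF il], of a b] st.R1[of i l a b] l ij by simp
  have "ys i j ((a + b) * 1) = comm H (ys i l a \<otimes> ys i l b) (ys l j 1)"
    by (rule comm_short_short[symmetric, OF _ _ _ _ _ _ sum ys_lift]) (use l ij in auto)
  also have "\<dots> = conjg H (ys i l a) (ys i j b) \<otimes> ys i j a"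
    using l ij by (simp add: comm_mult_left ys_R5)
  also have "conjg H (ys i l a) (ys i j b) = ys i j b"
    using l ij by (intro conjg_commuting ys_R3) auto
  also have "ys i j b \<otimes> ys i j a = ys i j a \<otimes> ys i j b"
    using l ij by (intro ys_R3) auto
  finally show ?thesis by simp
qed

lemma ys_zero: "short i j \<Longrightarrow> ys i j 0 = \<one>"
  using ys_R1[of i j 0 0] ys_closed[of i j 0] by simp

lemma ys_minus: "short i j \<Longrightarrow> ys i j (- a) = inv (ys i j a)"
  using ys_R1[of i j a "- a"] ys_zero[of i j]
  by (intro inv_equality[symmetric]) (auto simp: ys_R1)

lemma ys_mult_assoc: "\<lbrakk>short i j; x \<in> carrier H\<rbrakk> \<Longrightarrow> ys i j a \<otimes> (ys i j b \<otimes> x) = ys i j (a + b) \<otimes> x"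
  by (simp add: ys_R1 flip: m_assoc)

text \<open>
  Apply (R0) in \<open>G\<close> to both entries of a commutator defining the lift.  This reverses their order; the
  sign that appears is the one of \<open>eps l * eps (- l) = - bar_inv\<close>.
\<close>

lemma ys_R0:
  assumes ij: "short i j"
  shows "ys i j a = ys (- j) (- i) (eps (- j) * bar a * eps i)"
proof -
  obtain l where l: "l \<in> \<Omega>" "apart l i" "apart l j"
    by (rule fresh_index)
  have il: "short i l" and lj: "short l j"
    using l ij by auto
  have "lift (xs (- l) (- i) (eps (- l) * bar a * eps i)) (ys i l a)"
    using ys_lift[OF il] st.R0[of i l] il by simp
  moreover have "lift (xs (- j) (- l) (eps (- j) * bar 1 * eps l)) (ys l j 1)"
    using ys_lift[OF lj] st.R0[of l j] lj by simp
  ultimately have "comm H (ys l j 1) (ys i l a)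
      = ys (- j) (- i) ((eps (- j) * bar 1 * eps l) * (eps (- l) * bar a * eps i))"
    by (intro comm_short_short) (use l ij in auto)
  also have "(eps (- j) * bar 1 * eps l) * (eps (- l) * bar a * eps i)
      = eps (- j) * (bar 1 * ((eps l * eps (- l)) * (bar a * eps i)))"
    by (simp only: mult.assoc)
  also have "\<dots> = - (eps (- j) * bar a * eps i)"
    using l by (subst eps_eps_minus) (auto simp: mult.assoc)
  finally have "inv (comm H (ys l j 1) (ys i l a)) = ys (- j) (- i) (eps (- j) * bar a * eps i)"
    using ij by (simp add: ys_minus)
  moreover have "inv (comm H (ys l j 1) (ys i l a)) = ys i j (a * 1)"
    using l ij by (simp add: comm_inverse ys_R5)
  ultimately show ?thesis by simp
qed


section \<open>Lifts of the long root elements\<close>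

text \<open>
  The lift of \<open>X\<^sub>j(u, a)\<close> that \<open>long_from_short\<close> dictates, with auxiliary index \<open>k\<close>.
\<close>

definition yl_via :: "int \<Rightarrow> int \<Rightarrow> 'v \<Rightarrow> 'r \<Rightarrow> 'h" where
  "yl_via k j u a = ys k (- j) (eps k * bar a) \<otimes> comm H (xl_lift k (u, - bar a)) (ys (- k) (- j) 1)"

lemma yl_via_lift:
  assumes "short k j" "(u, a) \<in> L"
  shows "lift (xl j (u, a)) (yl_via k j u a)"
  unfolding yl_via_def st.long_from_short[OF assms]
  by (intro lift_mult lift_comm ys_lift xl_lift L_dual) (use assms in auto)

lemma yl_via_closed [simp]: "\<lbrakk>short k j; (u, a) \<in> L\<rbrakk> \<Longrightarrow> yl_via k j u a \<in> carrier H"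
  using yl_via_lift lift_closed by blast

lemma comm_to_yl_via:
  assumes kj: "short k j" and L: "(u, a) \<in> L" and x: "lift (xl k (u, - bar a)) x"
  shows "comm H x (ys (- k) (- j) 1) = ys k (- j) (- (eps k * bar a)) \<otimes> yl_via k j u a"
proof -
  have "comm H x (ys (- k) (- j) 1) = comm H (xl_lift k (u, - bar a)) (ys (- k) (- j) 1)"
    by (rule comm_lift_unique[OF x xl_lift ys_lift ys_lift]) (use kj L L_dual in auto)
  moreover have "comm H (xl_lift k (u, - bar a)) (ys (- k) (- j) 1) \<in> carrier H"
    using kj lift_closed[OF xl_lift[OF _ L_dual[OF L]]] by simp
  ultimately show ?thesis
    using kj by (simp add: yl_via_def ys_mult_assoc ys_zero)
qed

lemma yl_via_commute:
  assumes "short k j" "(u, a) \<in> L" "short h l" "h \<noteq> - j" "l \<noteq> j"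
  shows "yl_via k j u a \<otimes> ys h l b = ys h l b \<otimes> yl_via k j u a"
  by (rule lifts_commute_long_short[OF _ _ _ _ _ yl_via_lift ys_lift]) (use assms in auto)

text \<open>
  Relation (R6).  It has to precede the additivity (R2), whose proof moves one long root element past
  another one.
\<close>

lemma comm_lifts_long_long:
  assumes ij: "short i j" and L: "(u, a) \<in> L" "(v, b) \<in> L"
    and S: "lift (xl i (u, a)) S" and t: "lift (xl j (v, b)) t"
  shows "comm H S t = ys i (- j) (eps i * B u v)"
proof -
  obtain k where k: "k \<in> \<Omega>" "apart k i" "apart k j"
    by (rule fresh_index)
  have kj: "short k j" and ik: "short i k" and ij': "short i (- j)"
    using k ij by auto
  define T where "T = xl_lift k (v, - bar b)"
  let ?Z = "ys (- k) (- j) 1" and ?b = "ys k (- j) (eps k * bar b)"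
  have T: "lift (xl k (v, - bar b)) T"
    unfolding T_def using k L by (simp add: xl_lift L_dual)
  have e: "lift (xs i (- k) (eps i * B u v)) (comm H S T)"
    using lift_comm[OF S T] st.R6[of i k u a v "- bar b"] k ij L L_dual by auto
  note [simp] = S[THEN lift_closed] T[THEN lift_closed]
  have t': "lift (xl j (v, b)) (yl_via k j v b)"
    using kj L by (simp add: yl_via_lift)
  have TZ: "comm H T ?Z = ys k (- j) (- (eps k * bar b)) \<otimes> yl_via k j v b"
    using comm_to_yl_via[OF kj L(2) T] .
  have "comm H S (yl_via k j v b) = ys i (- j) (eps i * B u v * 1)"
  proof (rule comm_long_long)
    show "yl_via k j v b = ?b \<otimes> comm H T ?Z"
      by (simp add: yl_via_def T_def)
    show "S \<otimes> ?b = ?b \<otimes> S" "S \<otimes> ?Z = ?Z \<otimes> S"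
      by (rule lifts_commute_long_short[OF _ _ _ _ _ S ys_lift]; use ij k L in auto)+
    show "comm H (comm H S T) ?Z = ys i (- j) (eps i * B u v * 1)"
      by (rule comm_short_short[OF _ _ _ _ _ _ e ys_lift]) (use ij k in auto)
    show "comm H S T \<otimes> comm H T ?Z = comm H T ?Z \<otimes> comm H S T"
      unfolding TZ
    proof (rule commute_mult)
      show "comm H S T \<otimes> ys k (- j) (- (eps k * bar b)) = ys k (- j) (- (eps k * bar b)) \<otimes> comm H S T"
        by (rule lifts_commute_short_short[OF _ _ _ _ _ _ e ys_lift]) (use ij k in auto)
      show "comm H S T \<otimes> yl_via k j v b = yl_via k j v b \<otimes> comm H S T"
        by (rule lifts_commute_long_short[OF _ _ _ _ _ t' e, symmetric]) (use ij k L in auto)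
    qed (use kj L in auto)
    show "ys i (- j) (eps i * B u v * 1) \<otimes> yl_via k j v b = yl_via k j v b \<otimes> ys i (- j) (eps i * B u v * 1)"
      using kj L ij by (intro yl_via_commute[symmetric]) auto
  qed (use kj ij in auto)
  moreover have "comm H S (yl_via k j v b) = comm H S t"
    using S t t' by (blast intro: comm_lift_unique)
  ultimately show ?thesis by simp
qed

text \<open>
  The map \<open>(u, a) \<mapsto> (u, - bar a)\<close> reverses the order of products in the Heisenberg group; therefore
  the product \<open>y \<otimes> x\<close> is the one that lifts the parameter of the sum.
\<close>

lemma yl_via_R2:
  assumes ij: "short i j" and L: "(u, a) \<in> L" "(v, b) \<in> L"
  shows "yl_via i j u a \<otimes> yl_via i j v b = yl_via i j (u + v) (a + b + B u v)"
proof -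
  define x y where "x = xl_lift i (u, - bar a)" and "y = xl_lift i (v, - bar b)"
  let ?Z = "ys (- i) (- j) 1"
  note Ld = L_dual[OF L(1)] L_dual[OF L(2)]
  have x: "lift (xl i (u, - bar a)) x" and y: "lift (xl i (v, - bar b)) y"
    unfolding x_def y_def using ij Ld by (simp_all add: xl_lift)
  note [simp] = x[THEN lift_closed] y[THEN lift_closed]
  note [simp] = ij
  have bar_sum: "bar (a + b + B u v) = bar a + bar b - B v u"
    by (simp add: bar_add bar_form)
  have "lift (xl i (u + v, - bar (a + b + B u v))) (y \<otimes> x)"
    using lift_mult[OF y x] st.R2[OF _ Ld(2,1), of i] ij unfolding bar_sum
    by (simp add: algebra_simps)
  from comm_to_yl_via[OF ij L_mult[OF L] this, symmetric]
  have "ys i (- j) (- (eps i * bar (a + b + B u v))) \<otimes> yl_via i j (u + v) (a + b + B u v)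
      = comm H (y \<otimes> x) ?Z" .
  moreover have "- (eps i * bar (a + b + B u v)) = eps i * B v u - eps i * bar a - eps i * bar b"
    unfolding bar_sum by (simp add: algebra_simps)
  ultimately have "ys i (- j) (eps i * B v u - eps i * bar a - eps i * bar b)
        \<otimes> yl_via i j (u + v) (a + b + B u v) = comm H (y \<otimes> x) ?Z"
    by (simp only:)
  also have "\<dots> = conjg H y (ys i (- j) (- (eps i * bar a)) \<otimes> yl_via i j u a)
      \<otimes> (ys i (- j) (- (eps i * bar b)) \<otimes> yl_via i j v b)"
    by (simp add: comm_mult_left comm_to_yl_via[OF ij L(1) x] comm_to_yl_via[OF ij L(2) y])
  also have "conjg H y (ys i (- j) (- (eps i * bar a)) \<otimes> yl_via i j u a)
      = ys i (- j) (- (eps i * bar a)) \<otimes> (ys i (- j) (eps i * B v u) \<otimes> yl_via i j u a)"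
  proof -
    have "conjg H y (ys i (- j) (- (eps i * bar a))) = ys i (- j) (- (eps i * bar a))"
      by (intro conjg_commuting lifts_commute_long_short[OF _ _ _ _ _ y ys_lift]) (use ij Ld in auto)
    moreover have "comm H y (yl_via i j u a) = ys i (- j) (eps i * B v u)"
      by (rule comm_lifts_long_long[OF ij Ld(2) L(1) y yl_via_lift]) (use ij L in auto)
    ultimately show ?thesis
      using ij L by (simp add: conjg_mult conjg_eq_comm_mult[of y "yl_via i j u a"])
  qed
  also have "ys i (- j) (- (eps i * bar a)) \<otimes> (ys i (- j) (eps i * B v u) \<otimes> yl_via i j u a)
        \<otimes> (ys i (- j) (- (eps i * bar b)) \<otimes> yl_via i j v b)
      = ys i (- j) (eps i * B v u - eps i * bar a - eps i * bar b) \<otimes> (yl_via i j u a \<otimes> yl_via i j v b)"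
  proof -
    have "yl_via i j u a \<otimes> ys i (- j) (- (eps i * bar b)) = ys i (- j) (- (eps i * bar b)) \<otimes> yl_via i j u a"
      by (rule yl_via_commute) (use ij L in auto)
    from commute_left[OF this, of "yl_via i j v b"] show ?thesis
      using ij L by (simp add: m_assoc ys_mult_assoc)
  qed
  finally show ?thesis
    using ij L L_mult[OF L] by simp
qed


section \<open>Commutators of opposite short root elements\<close>

text \<open>
  The lift of \<open>X\<^sub>i(0, e + bar e)\<close> for \<open>a = eps i * e\<close>, as a commutator of opposite short root
  elements.
\<close>

definition zeta :: "int \<Rightarrow> 'r \<Rightarrow> 'h" where
  "zeta i a = (let k = SOME k. k \<in> \<Omega> \<and> apart k i in comm H (ys i k a) (ys k (- i) 1))"

lemma comm_opposite_lift:
  assumes "short i j"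
  shows "lift (xl i (0, - (eps (- i) * bar 1 * a * b) + bar b * bar_inv * bar a * eps i))
    (comm H (ys i j a) (ys j (- i) b))"
  using lift_comm[OF ys_lift[of i j a] ys_lift[of j "- i" b]] st.R9[of i j a b] assms by simp

lemma comm_opposite_commute:
  assumes "short i j" "short h l" "h \<noteq> - i" "l \<noteq> i"
  shows "comm H (ys i j a) (ys j (- i) b) \<otimes> ys h l c = ys h l c \<otimes> comm H (ys i j a) (ys j (- i) b)"
  by (rule lifts_commute_long_short[OF _ _ _ _ _ comm_opposite_lift ys_lift])
    (use assms L_opposite in auto)

text \<open>
  Moving \<open>c\<close> from one entry to the other changes the middle index.  This makes the commutator depend on
  the product of its parameters only.
\<close>

lemma comm_opposite_balanced:
  assumes ij: "short i j" and k: "k \<in> \<Omega>" "apart k i" "apart k j"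
  shows "comm H (ys i j (a * c)) (ys j (- i) b) = comm H (ys i k a) (ys k (- i) (c * b))"
proof -
  let ?P = "ys i k a" and ?Q = "ys k j c" and ?W = "ys j (- i) b" and ?q = "ys k (- i) (c * b)"
  have PQ: "comm H ?P ?Q = ys i j (a * c)" and QW: "comm H ?Q ?W = ?q"
    using ij k by (simp_all add: ys_R5)
  have q: "inv ?q = ys k (- i) (- (c * b))"
    using ij k by (simp add: ys_minus)
  have "comm H ?W (ys i j (a * c)) = comm H ?P (inv ?q)"
    unfolding PQ[symmetric]
  proof (rule comm_comm_swap)
    show "comm H ?W ?Q = inv ?q"
      using ij k by (simp flip: QW add: comm_inverse)
    show "?W \<otimes> ?P = ?P \<otimes> ?W"
      by (rule ys_R3) (use ij k in auto)
    show "inv ?q \<otimes> comm H ?P ?Q = comm H ?P ?Q \<otimes> inv ?q"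
      unfolding PQ q by (rule ys_R3) (use ij k in auto)
  qed (use ij k in auto)
  also have "\<dots> = inv (comm H ?P ?q)"
    by (rule comm_inv_right) (use ij k comm_opposite_commute[symmetric] in auto)
  finally have "inv (comm H ?W (ys i j (a * c))) = comm H ?P ?q"
    using ij k by simp
  then show ?thesis
    using ij k by (simp add: comm_inverse)
qed

lemma comm_opposite:
  assumes ij: "short i j"
  shows "comm H (ys i j a) (ys j (- i) b) = zeta i (a * b)"
proof -
  define P where "P k \<longleftrightarrow> k \<in> \<Omega> \<and> apart k i" for k
  define k where "k = (SOME k. P k)"
  have "P j"
    using ij by (simp add: P_def)
  then have "P k"
    unfolding k_def by (rule someI)
  then have k: "k \<in> \<Omega>" "apart k i"
    by (auto simp: P_def)
  have zeta: "zeta i c = comm H (ys i k c) (ys k (- i) 1)" for c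
    by (simp add: zeta_def Let_def k_def P_def)
  have move: "comm H (ys i h a) (ys h (- i) b) = comm H (ys i l (a * b)) (ys l (- i) 1)"
    if "h \<in> \<Omega>" "apart h i" "l \<in> \<Omega>" "apart l i" "apart l h" for h l a b
    using comm_opposite_balanced[of i l h a b 1] that ij by simp
  obtain m where m: "m \<in> \<Omega>" "apart m i" "apart m j"
    by (rule fresh_index)
  show ?thesis
  proof (cases "apart k j")
    case True
    then show ?thesis
      using move[of j k] ij k zeta by simp
  next
    case False
    then show ?thesis
      using move[of j m] move[of m k] ij k m zeta apart_cong[OF False m(3)] by simp
  qed
qed

lemma zeta_lift:
  assumes "i \<in> \<Omega>"
  shows "lift (xl i (0, - (eps (- i) * bar 1 * a) + bar a * eps i)) (zeta i a)"
proof -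
  obtain j where "j \<in> \<Omega>" "apart j i"
    by (rule fresh_index)
  then show ?thesis
    using comm_opposite_lift[of i j a 1] comm_opposite[of i j a 1] assms by simp
qed

lemma zeta_closed [simp]: "i \<in> \<Omega> \<Longrightarrow> zeta i a \<in> carrier H"
  using zeta_lift lift_closed by blast

lemma zeta_commute:
  assumes "i \<in> \<Omega>" "short h l" "h \<noteq> - i" "l \<noteq> i"
  shows "zeta i a \<otimes> ys h l c = ys h l c \<otimes> zeta i a"
proof -
  obtain j where "j \<in> \<Omega>" "apart j i"
    by (rule fresh_index)
  then show ?thesis
    using comm_opposite_commute[of i j h l a 1 c] comm_opposite[of i j a 1] assms by simp
qed

lemma zeta_minus:
  assumes i: "i \<in> \<Omega>"
  shows "zeta i (- a) = inv (zeta i a)"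
proof -
  obtain j where j: "j \<in> \<Omega>" "apart j i"
    by (rule fresh_index)
  have z: "comm H (ys i j c) (ys j (- i) 1) = zeta i c" for c
    using comm_opposite[of i j c 1] i j by simp
  have "comm H (inv (ys i j a)) (ys j (- i) 1) = inv (comm H (ys i j a) (ys j (- i) 1))"
    by (rule comm_inv_left) (use i j z zeta_commute[symmetric] in auto)
  then show ?thesis
    using i j by (simp add: z flip: ys_minus)
qed

text \<open>
  The two ways to lift \<open>X\<^sub>j(0, e + bar e)\<close>, by (R8) and by (R9), agree.  The commutator occurring
  in the first one is evaluated after writing the long root element for \<open>i\<close> by (R9).
\<close>

lemma yl_via_zero:
  assumes ij: "short i j"
  shows "yl_via i j 0 (e + bar e) = zeta j (eps j * e)"
proof -
  obtain m where m: "m \<in> \<Omega>" "apart m i" "apart m j"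
    by (rule fresh_index)
  have nz: "i \<noteq> 0" "m \<noteq> 0"
    using ij m by auto
  \<comment> \<open>the signs of \<open>e\<close> come from \<open>- bar (e + bar e) = - e - bar e\<close>, the parameter of the element for \<open>i\<close>\<close>
  let ?P = "ys i m (- (eps i * e))" and ?Q = "ys m (- i) 1" and ?Z = "ys (- i) (- j) 1"
  let ?p = "ys j m (- (eps j * e))" and ?q = "ys m (- j) 1"
  let ?x = "ys i (- j) (- (eps i * e))" and ?y = "ys i (- j) (- (eps i * bar e))"
  note be = bar_eps[of _ "- e", simplified]
  \<comment> \<open>rewriting by (R0) makes the inner indices of a commutator equal, as (R5) requires\<close>
  have P: "?P = ys (- m) (- i) (- (eps (- m) * bar e))"
    using ys_R0[of i m "- (eps i * e)"] ij m be by (simp add: mult.assoc bar_minus)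
  have p: "?p = ys (- m) (- j) (- (eps (- m) * bar e))"
    using ys_R0[of j m "- (eps j * e)"] ij m be by (simp add: mult.assoc bar_minus)
  have Q: "?Q = ys i (- m) (eps i * bar 1 * eps m)"
    using ys_R0[of m "- i" 1] ij m by simp
  have "eps i * bar 1 * eps m * (- (eps (- m) * bar e)) = eps i * bar e"
    using eps_eps_minus[OF nz(2)] by (simp add: mult.assoc flip: mult.assoc[of "eps m" "eps (- m)"])
  then have Qp: "comm H ?Q ?p = inv ?y"
    unfolding Q p using ij m ys_R5[of i "- m" "- j"] by (simp flip: ys_minus)
  have PZ: "comm H ?P ?Z = ?p"
    unfolding P p using ij m ys_R5[of "- m" "- i" "- j"] by simp
  have pq: "comm H ?p ?q = zeta j (- (eps j * e))"
    using comm_opposite[of j m] ij m by simp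
  have PQ: "comm H ?P ?Q = zeta i (- (eps i * e))"
    using comm_opposite[of i m] ij m by simp
  have "comm H (comm H ?P ?Q) ?Z = ?y \<otimes> ?x \<otimes> inv (comm H ?p ?q)"
  proof (rule comm_central_long[OF _ _ _ _ _ _ _ _ PZ _ Qp])
    show "comm H ?Q ?Z = ?q" "comm H ?P ?q = ?x"
      using ij m by (simp_all add: ys_R5)
    show "?p \<otimes> comm H ?p ?q = comm H ?p ?q \<otimes> ?p" "?q \<otimes> comm H ?p ?q = comm H ?p ?q \<otimes> ?q"
      unfolding pq by (rule zeta_commute[symmetric]; use ij m in auto)+
  qed ((rule ys_R3)?; use ij m in auto)+
  then have eq: "comm H (zeta i (- (eps i * e))) ?Z = ys i (- j) (- (eps i * (bar e + e))) \<otimes> zeta j (eps j * e)"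
    unfolding PQ pq using ij by (simp add: ys_R1 distrib_left flip: zeta_minus)
  have "eps (- i) * bar 1 * (eps i * e) = - e"
    using eps_bar_one_eps_minus[of "- i" e] nz by (simp add: mult.assoc)
  moreover have "- bar (e + bar e) = - e - bar e"
    by (simp add: bar_add bar_bar)
  ultimately have "lift (xl i (0, - bar (e + bar e))) (zeta i (- (eps i * e)))"
    using zeta_lift[of i "- (eps i * e)"] ij be[of i] by (simp add: bar_minus)
  from comm_to_yl_via[OF ij L_min this] eq
  have "ys i (- j) (- (eps i * (bar e + e))) \<otimes> yl_via i j 0 (e + bar e)
      = ys i (- j) (- (eps i * (bar e + e))) \<otimes> zeta j (eps j * e)"
    by (simp add: bar_add bar_bar)
  then show ?thesis
    using ij L_min by simp
qed


section \<open>Commutators of long and short root elements\<close>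

text \<open>
  The right-hand side is not yet that of (R8): the long root element has the parameter
  \<open>b' a b\<close> instead of \<open>- b' (bar a) b\<close>, with \<open>b' = bar b * bar_inv\<close>, and is corrected by an element
  \<open>zeta\<close>, because \<open>X\<^bsub>-i,j\<^esub>(b)\<close> and \<open>X\<^sub>i\<^sub>j\<close> do not commute.
\<close>

lemma comm_long_short_aux:
  assumes ij: "short i j" and k: "k \<in> \<Omega>" "apart k i" "apart k j" and L: "(u, a) \<in> L"
    and S: "lift (xl i (u, a)) S"
  shows "comm H S (ys (- i) j b)
    = yl_via k (- j) (act u b) (bar b * bar_inv * a * b)
      \<otimes> (zeta (- j) (- (eps (- j) * (bar b * bar_inv * bar a * b))) \<otimes> ys i j (eps i * a * b))"
proof -
  let ?Y = "ys (- i) (- k) b" and ?Z = "ys (- k) j 1" and ?W = "ys (- i) j b"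
  let ?c = "eps i * a * b" and ?d = "bar b * bar_inv * bar a * b" and ?d' = "bar b * bar_inv * a * b"
  let ?p = "ys i (- k) ?c" and ?q = "ys i j ?c"
  let ?m = "ys k j (- (eps k * ?d))" and ?r = "ys k j (eps k * ?d)" and ?y = "yl_via k (- j) (act u b) ?d'"
  have bar_c: "bar ?c * eps i = bar b * bar_inv * bar a"
    using bar_eps[of i "a * b"] by (simp add: mult.assoc bar_mult)
  have bar_d': "bar ?d' = ?d"
    by (simp add: bar_simps)
  have L': "(act u b, ?d') \<in> L" and Ld: "(act u b, - ?d) \<in> L"
    using heis_act_L[OF L, of b] L_dual[OF heis_act_L[OF L, of b]] unfolding bar_d' by auto
  have heis: "heis_act (u, - bar a) b = (act u b, - ?d)"
    by (simp add: heis_act_def)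
  \<comment> \<open>some lift of the long factor in (R8) for \<open>i\<close> and \<open>-k\<close>; the choice makes that relation exact\<close>
  define t where "t = inv ?p \<otimes> comm H S ?Y"
  note [simp] = S[THEN lift_closed]
  have p: "?p \<in> carrier H" and YZ: "?Y \<in> carrier H" "?Z \<in> carrier H" "?m \<in> carrier H" "?r \<in> carrier H"
      "?q \<in> carrier H" "?y \<in> carrier H"
    using ij k L' by auto
  have SY: "comm H S ?Y = ?p \<otimes> t"
    using p YZ by (simp add: t_def)
  have t: "lift (xl k (act u b, - ?d)) t"
  proof -
    have "lift (xs i (- k) ?c \<otimes>\<^bsub>G\<^esub> xl k (act u b, - ?d)) (comm H S ?Y)"
      using lift_comm[OF S ys_lift[of "- i" "- k" b]] st.R8[of i "- k" u a b] ij k L heis by simp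
    moreover have "lift (xs i (- k) (- ?c)) (inv ?p)"
      using ys_lift[of i "- k" "- ?c"] ys_minus[of i "- k"] ij k by simp
    ultimately have "lift (xs i (- k) (- ?c) \<otimes>\<^bsub>G\<^esub> (xs i (- k) ?c \<otimes>\<^bsub>G\<^esub> xl k (act u b, - ?d))) t"
      unfolding t_def by (intro lift_mult)
    then show ?thesis
      using st.xs_cancel[of i "- k" "xl k (act u b, - ?d)" "- ?c"] ij k Ld by (simp add: st.xl_closed)
  qed
  have W: "?W = comm H ?Y ?Z"
    using ij k by (simp add: ys_R5)
  have p': "?p = ys k (- i) (eps k * (bar b * bar_inv * bar a))"
    using ys_R0[of i "- k" ?c] ij k bar_c by (simp add: mult.assoc)
  have "comm H S ?W = ?y \<otimes> conjg H ?W ?q"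
  proof (rule comm_comm_long[OF _ _ _ _ _ _ _ _ _ _ SY W])
    show "S \<otimes> ?Z = ?Z \<otimes> S"
      by (rule lifts_commute_long_short[OF _ L _ _ _ S ys_lift]) (use ij k in auto)
    show "t \<otimes> ?W = ?W \<otimes> t"
      by (rule lifts_commute_long_short[OF _ Ld _ _ _ t ys_lift]) (use ij k in auto)
    show "comm H ?p ?W = ?r"
      unfolding p' using ys_R5[of k "- i" j] ij k by (simp add: mult.assoc)
    show "comm H t ?Z = ?m \<otimes> ?y"
      using comm_to_yl_via[of k "- j" "act u b" ?d' t] t L' ij k bar_d' by simp
    show "comm H ?p ?Z = ?q"
      using ys_R5[of i "- k" j] ij k by simp
    show "?p \<otimes> ?m = ?m \<otimes> ?p" "?W \<otimes> ?m = ?m \<otimes> ?W"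
      by (rule ys_R3; use ij k in auto)+
    show "?p \<otimes> ?y = ?y \<otimes> ?p" "?W \<otimes> ?y = ?y \<otimes> ?W"
      by (rule yl_via_commute[symmetric]; use ij k L' in auto)+
    show "?r \<otimes> ?m = \<one>"
      using ij k by (simp add: ys_R1 ys_zero)
  qed (use t lift_closed p YZ in auto)
  also have "conjg H ?W ?q = inv (comm H ?q ?W) \<otimes> ?q"
    using ij by (simp add: conjg_eq_comm_mult comm_inverse)
  also have "comm H ?q ?W = zeta (- j) (eps (- j) * ?d)"
  proof -
    have "?q = ys (- j) (- i) (eps (- j) * (bar b * bar_inv * bar a))"
      using ys_R0[of i j ?c] ij bar_c by (simp add: mult.assoc)
    then show ?thesis
      using comm_opposite[of "- j" "- i" "eps (- j) * (bar b * bar_inv * bar a)" b] ij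
      by (simp add: mult.assoc)
  qed
  finally show ?thesis
    using ij by (simp add: zeta_minus)
qed

text \<open>
  By (R2) and \<open>yl_via_zero\<close>, the factor \<open>zeta\<close> turns the parameter of the long root element into the
  one in (R8).
\<close>

lemma comm_long_short:
  assumes ij: "short i j" and k: "k \<in> \<Omega>" "apart k i" "apart k j" and L: "(u, a) \<in> L"
    and S: "lift (xl i (u, a)) S"
  shows "comm H S (ys (- i) j b)
    = ys i j (eps i * a * b) \<otimes> yl_via k (- j) (act u b) (- (bar b * bar_inv * bar a * b))"
proof -
  let ?d = "bar b * bar_inv * bar a * b" and ?d' = "bar b * bar_inv * a * b"
  have kj: "short k (- j)"
    using ij k by auto
  have bar_d: "bar (- ?d) = - ?d'"
    by (simp add: bar_simps)
  have L': "(act u b, ?d') \<in> L"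
    using heis_act_L[OF L] .
  have Ld: "(act u b, - ?d) \<in> L"
    using L_mult[OF L' L_min[of "- ?d"]] unfolding bar_d by simp
  have "zeta (- j) (- (eps (- j) * ?d)) = yl_via k (- j) 0 (- ?d + bar (- ?d))"
    using yl_via_zero[OF kj, of "- ?d"] by simp
  moreover have "yl_via k (- j) (act u b) ?d' \<otimes> yl_via k (- j) 0 (- ?d + bar (- ?d))
      = yl_via k (- j) (act u b) (- ?d)"
    using yl_via_R2[OF kj L' L_min[of "- ?d"]] unfolding bar_d by simp
  ultimately have "comm H S (ys (- i) j b) = yl_via k (- j) (act u b) (- ?d) \<otimes> ys i j (eps i * a * b)"
    using comm_long_short_aux[OF assms, of b] kj ij L' L_min[of "- ?d"] by (simp flip: m_assoc)
  also have "\<dots> = ys i j (eps i * a * b) \<otimes> yl_via k (- j) (act u b) (- ?d)"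
    by (rule yl_via_commute[OF kj Ld]) (use ij in auto)
  finally show ?thesis .
qed

text \<open>
  The case \<open>b = 1\<close> of \<open>comm_long_short\<close> has the auxiliary index \<open>k\<close> on one side and the definition of
  the lift with auxiliary index \<open>i\<close> on the other.
\<close>

lemma yl_via_indep_apart:
  assumes ij: "short i j" and k: "k \<in> \<Omega>" "apart k i" "apart k j" and L: "(u, a) \<in> L"
  shows "yl_via i j u a = yl_via k j u a"
proof -
  have "comm H (xl_lift i (u, - bar a)) (ys (- i) (- j) 1)
      = ys i (- j) (- (eps i * bar a)) \<otimes> yl_via k j u a"
    using comm_long_short[of i "- j" k u "- bar a" "xl_lift i (u, - bar a)" 1] ij k L_dual[OF L]
    by (simp add: act_one bar_minus bar_bar xl_lift)
  then show ?thesis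
    using ij k L by (simp add: yl_via_def[of i] ys_mult_assoc ys_zero)
qed

definition yl :: "int \<Rightarrow> 'v \<times> 'r \<Rightarrow> 'h" where
  "yl j \<xi> = yl_via (SOME k. k \<in> \<Omega> \<and> apart k j) j (fst \<xi>) (snd \<xi>)"

lemma yl_eq:
  assumes ij: "short i j" and L: "(u, a) \<in> L"
  shows "yl j (u, a) = yl_via i j u a"
proof -
  define P where "P k \<longleftrightarrow> k \<in> \<Omega> \<and> apart k j" for k
  define k where "k = (SOME k. P k)"
  have "P i"
    using ij by (simp add: P_def)
  then have "P k"
    unfolding k_def by (rule someI)
  then have k: "k \<in> \<Omega>" "apart k j"
    by (auto simp: P_def)
  have yl: "yl j (u, a) = yl_via k j u a"
    by (simp add: yl_def k_def P_def)
  obtain m where m: "m \<in> \<Omega>" "apart m i" "apart m j" "apart m k"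
    by (rule fresh_index)
  show ?thesis
    using yl_via_indep_apart[of i j m u a] yl_via_indep_apart[of k j m u a] ij k m L yl by simp
qed

lemma yl_lift:
  assumes "i \<in> \<Omega>" "\<xi> \<in> L"
  shows "lift (xl i \<xi>) (yl i \<xi>)"
proof -
  obtain k where k: "k \<in> \<Omega>" "apart k i"
    by (rule fresh_index)
  show ?thesis
    using yl_via_lift[of k i] yl_eq[of k i] k assms by (cases \<xi>) auto
qed

lemma yl_R2:
  assumes "i \<in> \<Omega>" "(u, a) \<in> L" "(v, b) \<in> L"
  shows "yl i (u, a) \<otimes> yl i (v, b) = yl i (u + v, a + b + B u v)"
proof -
  obtain k where k: "k \<in> \<Omega>" "apart k i"
    by (rule fresh_index)
  then show ?thesis
    using yl_eq[of k i] yl_via_R2[of k i u a v b] L_mult[OF assms(2,3)] assms by simp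
qed

text \<open>
  A consequence of (R2): both products \<open>(u, a) (v, b)\<close> and \<open>(v, b) (u, a)\<close> in the Heisenberg group
  have the same first component, and they differ by the central element \<open>(0, B u v - B v u)\<close>.
\<close>

lemma yl_R7:
  assumes i: "i \<in> \<Omega>" and L: "(u, a) \<in> L" "(v, b) \<in> L"
  shows "comm H (yl i (u, a)) (yl i (v, b)) = yl i (0, B u v - B v u)"
proof -
  note L0 = L_form[of u v]
  have closed [simp]: "yl i \<xi> \<in> carrier H" if "\<xi> \<in> L" for \<xi>
    using yl_lift[OF i that] lift_closed by blast
  have "yl i (0, B u v - B v u) \<otimes> (yl i (v, b) \<otimes> yl i (u, a)) = yl i (u, a) \<otimes> yl i (v, b)"
    using L L0 L_mult[OF L(2,1)]
    by (simp add: yl_R2[OF i] algebra_simps)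
  then have "yl i (u, a) \<otimes> yl i (v, b) \<otimes> inv (yl i (v, b) \<otimes> yl i (u, a)) = yl i (0, B u v - B v u)"
    using L L0 by (intro inv_solve_right'[THEN iffD2]) auto
  then show ?thesis
    using L by (simp add: comm_def inv_mult_group m_assoc)
qed

theorem lifted_family: "steinberg_family bar act B L H \<Omega> ys yl"
proof unfold_locales
  show "0 \<notin> \<Omega>" "\<And>i. i \<in> \<Omega> \<Longrightarrow> - i \<in> \<Omega>"
    by auto
  show "\<And>i j a. \<lbrakk>i \<in> \<Omega>; j \<in> \<Omega>; apart i j\<rbrakk> \<Longrightarrow> ys i j a \<in> carrier H"
    by simp
  show "\<And>i \<xi>. \<lbrakk>i \<in> \<Omega>; \<xi> \<in> L\<rbrakk> \<Longrightarrow> yl i \<xi> \<in> carrier H"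
    using yl_lift lift_closed by blast
  show "\<And>i j a. \<lbrakk>i \<in> \<Omega>; j \<in> \<Omega>; apart i j\<rbrakk> \<Longrightarrow> ys i j a = ys (- j) (- i) (eps (- j) * bar a * eps i)"
    by (rule ys_R0) auto
  show "\<And>i j a b. \<lbrakk>i \<in> \<Omega>; j \<in> \<Omega>; apart i j\<rbrakk> \<Longrightarrow> ys i j a \<otimes> ys i j b = ys i j (a + b)"
    by (rule ys_R1) auto
  show "\<And>i u a v b. \<lbrakk>i \<in> \<Omega>; (u, a) \<in> L; (v, b) \<in> L\<rbrakk>
      \<Longrightarrow> yl i (u, a) \<otimes> yl i (v, b) = yl i (u + v, a + b + B u v)"
    by (rule yl_R2)
  show "\<And>i j h k a b. \<lbrakk>i \<in> \<Omega>; j \<in> \<Omega>; apart i j; h \<in> \<Omega>; k \<in> \<Omega>; apart h k;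
        h \<noteq> j; h \<noteq> - i; k \<noteq> i; k \<noteq> - j\<rbrakk> \<Longrightarrow> ys i j a \<otimes> ys h k b = ys h k b \<otimes> ys i j a"
    by (rule ys_R3) auto
  show "\<And>i \<xi> j k a. \<lbrakk>i \<in> \<Omega>; \<xi> \<in> L; j \<in> \<Omega>; k \<in> \<Omega>; apart j k; j \<noteq> - i; k \<noteq> i\<rbrakk>
      \<Longrightarrow> yl i \<xi> \<otimes> ys j k a = ys j k a \<otimes> yl i \<xi>"
    by (rule lifts_commute_long_short[OF _ _ _ _ _ yl_lift ys_lift]) auto
  show "\<And>i j k a b. \<lbrakk>i \<in> \<Omega>; j \<in> \<Omega>; k \<in> \<Omega>; apart i j; apart j k; apart i k\<rbrakk>
      \<Longrightarrow> comm H (ys i j a) (ys j k b) = ys i k (a * b)"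
    by (rule ys_R5)
  show "\<And>i j u a v b. \<lbrakk>i \<in> \<Omega>; j \<in> \<Omega>; apart i j; (u, a) \<in> L; (v, b) \<in> L\<rbrakk>
      \<Longrightarrow> comm H (yl i (u, a)) (yl j (v, b)) = ys i (- j) (eps i * B u v)"
    by (rule comm_lifts_long_long[OF _ _ _ yl_lift yl_lift]) auto
  show "\<And>i u a v b. \<lbrakk>i \<in> \<Omega>; (u, a) \<in> L; (v, b) \<in> L\<rbrakk>
      \<Longrightarrow> comm H (yl i (u, a)) (yl i (v, b)) = yl i (0, B u v - B v u)"
    by (rule yl_R7)
  show "comm H (yl i (u, a)) (ys (- i) j b)
      = ys i j (eps i * a * b) \<otimes> yl (- j) (heis_act (u, - bar a) b)"
    if "i \<in> \<Omega>" "j \<in> \<Omega>" "apart i j" "(u, a) \<in> L" for i j u a b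
  proof -
    obtain k where k: "k \<in> \<Omega>" "apart k i" "apart k j"
      by (rule fresh_index)
    show ?thesis
      using that k comm_long_short[of i j k u a "yl i (u, a)" b] yl_eq[of k "- j"]
        L_act[OF L_dual[OF that(4)], of b]
      by (simp add: yl_lift heis_act_def)
  qed
  show "comm H (ys i j a) (ys j (- i) b)
      = yl i (0, - eps (- i) * bar 1 * a * b + bar b * bar_inv * bar a * eps i)"
    if "i \<in> \<Omega>" "j \<in> \<Omega>" "apart i j" for i j a b
  proof -
    have i: "i \<noteq> 0"
      using that by auto
    let ?e = "- eps (- i) * bar 1 * a * b"
    have "bar ?e = bar b * bar_inv * bar a * eps i"
      using i by (auto simp: eps_def bar_simps)
    moreover have "eps i * ?e = a * b"
      using i by (auto simp: eps_def mult.assoc)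
    ultimately have "yl i (0, ?e + bar b * bar_inv * bar a * eps i) = zeta i (a * b)"
      using yl_via_zero[of j i ?e] yl_eq[of j i] L_min[of ?e] that by simp
    then show ?thesis
      using comm_opposite that by simp
  qed
qed

end


section \<open>The Schur multiplier\<close>

lemma hom_eq_on_generate:
  assumes "group G" "group H" "g \<in> hom G H" "h \<in> hom G H" "S \<subseteq> carrier G"
    and eq: "\<And>s. s \<in> S \<Longrightarrow> g s = h s" and x: "x \<in> generate G S"
  shows "g x = h x"
proof -
  interpret g: group_hom G H g
    using assms by (intro group_hom.intro group_hom_axioms.intro)
  interpret h: group_hom G H h
    using assms by (intro group_hom.intro group_hom_axioms.intro)
  show ?thesis
    using x
  proof (induction rule: generate.induct)
    case (eng x y)
    then show ?case
      using g.G.generate_in_carrier[OF assms(5)] by simp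
  qed (use eq assms(5) in auto)
qed

context steinberg_extension
begin

text \<open>
  Two sections of a central extension agree on commutators, and every generator is a product of
  commutators.
\<close>

lemma sections_unique:
  assumes gen: "carrier G \<subseteq> generate G st.generators"
    and g: "g \<in> hom G H" "\<And>x. x \<in> carrier G \<Longrightarrow> \<pi> (g x) = x"
    and h: "h \<in> hom G H" "\<And>x. x \<in> carrier G \<Longrightarrow> \<pi> (h x) = x"
    and x: "x \<in> carrier G"
  shows "g x = h x"
proof -
  have groups: "group G" "group H"
    by unfold_locales
  have lifts: "lift x (g x)" "lift x (h x)" if "x \<in> carrier G" for x
    using that g h by (auto simp: lift_def hom_def)
  have comm: "g (comm G x y) = h (comm G x y)" if "x \<in> carrier G" "y \<in> carrier G" for x y
    using hom_comm[OF groups g(1)] hom_comm[OF groups h(1)] comm_lift_unique[OF lifts lifts] that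
    by simp
  have short: "g (xs i j a) = h (xs i j a)" if ij: "short i j" for i j a
  proof -
    obtain k where k: "k \<in> \<Omega>" "apart k i" "apart k j"
      by (rule fresh_index)
    then have "xs i j a = comm G (xs i k a) (xs k j 1)"
      using st.R5[of i k j a 1] ij by simp
    then show ?thesis
      using comm ij k st.xs_closed by simp
  qed
  have long: "g (xl j (u, a)) = h (xl j (u, a))" if j: "j \<in> \<Omega>" and L: "(u, a) \<in> L" for j u a
  proof -
    obtain k where k: "k \<in> \<Omega>" "apart k j"
      by (rule fresh_index)
    have "comm G (xl k (u, - bar a)) (xs (- k) (- j) 1) \<in> carrier G" "xs k (- j) (eps k * bar a) \<in> carrier G"
      using j k st.xs_closed st.xl_closed[OF _ L_dual[OF L]] by simp_all
    then show ?thesis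
      using st.long_from_short[of k j u a] j k L short[of k "- j"] comm st.xs_closed
        st.xl_closed[OF _ L_dual[OF L]] Group.hom_mult[OF g(1)] Group.hom_mult[OF h(1)] by simp
  qed
  show ?thesis
  proof (rule hom_eq_on_generate[OF groups g(1) h(1) st.generators_closed])
    show "x \<in> generate G st.generators"
      using gen x by blast
  qed (use short long in \<open>auto simp: st.generators_def\<close>)
qed

end

text \<open>
  If all central extensions of \<open>G\<close> split uniquely, then \<open>G\<close> is its own universal central extension.
  A universal central extension \<open>\<pi> : U \<rightarrow> G\<close> on the tested type splits itself, by \<open>\<eta>\<close> say; then
  \<open>\<eta> \<circ> \<pi>\<close> and the identity are both endomorphisms of \<open>U\<close> over \<open>G\<close>, hence equal, and \<open>\<pi>\<close> is
  injective.
\<close>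

lemma schur_multiplier_trivialI:
  fixes G :: "'g monoid"
  assumes fam: "steinberg_family bar act B L G \<Omega> xs xl" and five: "{1..5} \<subseteq> \<Omega>"
    and gen: "carrier G \<subseteq> generate G (steinberg_family.generators L \<Omega> xs xl)"
    and univ: "\<And>(H :: 'h monoid) ys yl. steinberg_family bar act B L H \<Omega> ys yl \<Longrightarrow>
      \<exists>h\<in>hom G H. (\<forall>i\<in>\<Omega>. \<forall>j\<in>\<Omega>. \<forall>a. apart i j \<longrightarrow> h (xs i j a) = ys i j a)
        \<and> (\<forall>i\<in>\<Omega>. \<forall>\<xi>\<in>L. h (xl i \<xi>) = yl i \<xi>)"
  shows "schur_multiplier_trivial TYPE('h) G"
proof -
  interpret st: steinberg_family bar act B L G \<Omega> xs xl
    by (rule fam)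
  have G: "group G" by unfold_locales
  have split: "\<exists>!\<eta>. \<eta> \<in> hom G H \<inter> extensional (carrier G) \<and> (\<forall>x\<in>carrier G. \<epsilon> (\<eta> x) = x)"
    if "central_extension H G \<epsilon>" for H :: "'h monoid" and \<epsilon>
  proof -
    interpret H: group H
      using that by (simp add: central_extension_def)
    interpret central_ext H G \<epsilon>
      using that by unfold_locales (auto simp: central_extension_def epi_def)
    interpret steinberg_extension bar act B L H G \<epsilon> \<Omega> xs xl
      by unfold_locales (rule five)
    obtain h where h: "h \<in> hom G H" "\<And>i j a. short i j \<Longrightarrow> h (xs i j a) = ys i j a"
      "\<And>i \<xi>. \<lbrakk>i \<in> \<Omega>; \<xi> \<in> L\<rbrakk> \<Longrightarrow> h (xl i \<xi>) = yl i \<xi>"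
      using univ[OF lifted_family] by blast
    have retract: "\<epsilon> (h x) = x" if x: "x \<in> carrier G" for x
    proof -
      have "(\<epsilon> \<circ> h) x = (\<lambda>x. x) x"
      proof (rule hom_eq_on_generate[OF G G _ _ st.generators_closed])
        show "\<epsilon> \<circ> h \<in> hom G G"
          using h(1) hom by (rule hom_compose)
        show "(\<lambda>x. x) \<in> hom G G"
          by (simp add: hom_def)
        show "(\<epsilon> \<circ> h) s = s" if "s \<in> st.generators" for s
          using that h(2,3) ys_lift yl_lift by (auto simp: st.generators_def lift_def)
        show "x \<in> generate G st.generators"
          using gen x by blast
      qed
      then show ?thesis by simp
    qed
    show ?thesis
    proof (rule ex1I[of _ "restrict h (carrier G)"])
      show "restrict h (carrier G) \<in> hom G H \<inter> extensional (carrier G)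
          \<and> (\<forall>x\<in>carrier G. \<epsilon> (restrict h (carrier G) x) = x)"
        using h(1) retract by (auto simp: hom_def)
      fix \<eta>
      assume \<eta>: "\<eta> \<in> hom G H \<inter> extensional (carrier G) \<and> (\<forall>x\<in>carrier G. \<epsilon> (\<eta> x) = x)"
      show "\<eta> = restrict h (carrier G)"
      proof (rule extensionalityI)
        show "\<eta> x = restrict h (carrier G) x" if "x \<in> carrier G" for x
          using sections_unique[OF gen _ _ h(1) retract that, of \<eta>] \<eta> that by simp
      qed (use \<eta> in auto)
    qed
  qed
  show ?thesis
    unfolding schur_multiplier_trivial_def
  proof (intro conjI allI impI)
    let ?M = "G\<lparr>carrier := kernel G G (\<lambda>x. x)\<rparr>"
    have hom: "(\<lambda>x. x) \<in> hom G G"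
      by (simp add: hom_def)
    have ker: "kernel G G (\<lambda>x. x) = {\<one>\<^bsub>G\<^esub>}"
      by (auto simp: kernel_def)
    have "central_extension G G (\<lambda>x. x)"
      using hom G by (simp add: central_extension_def epi_def ker)
    then have "universal_central_extension TYPE('h) G G (\<lambda>x. x)"
      using split by (simp add: universal_central_extension_def)
    then have "is_schur_multiplier TYPE('h) G ?M"
      unfolding is_schur_multiplier_def by blast
    moreover have "trivial_group ?M"
      using st.subgroup_imp_group[OF st.triv_subgroup] by (simp add: trivial_group_def ker)
    ultimately show "\<exists>M :: 'g monoid. is_schur_multiplier TYPE('h) G M \<and> trivial_group M"
      by blast
  next
    fix M :: "'h monoid"
    assume "is_schur_multiplier TYPE('h) G M"
    then obtain U \<pi> where U: "universal_central_extension TYPE('h) U G \<pi>"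
      and M: "M = U\<lparr>carrier := kernel U G \<pi>\<rparr>"
      unfolding is_schur_multiplier_def by blast
    have ext: "central_extension U G \<pi>"
      using U by (simp add: universal_central_extension_def)
    then have \<pi>: "\<pi> \<in> hom U G" and Ug: "group U"
      by (auto simp: central_extension_def epi_def)
    interpret \<pi>: group_hom U G \<pi>
      using \<pi> Ug G by (intro group_hom.intro group_hom_axioms.intro)
    obtain \<eta> where \<eta>: "\<eta> \<in> hom G U" "\<And>x. x \<in> carrier G \<Longrightarrow> \<pi> (\<eta> x) = x"
      using split[OF ext] by blast
    let ?Q = "\<lambda>\<theta>. \<theta> \<in> hom U U \<inter> extensional (carrier U) \<and> (\<forall>x\<in>carrier U. \<pi> (\<theta> x) = \<pi> x)"
    have "\<exists>!\<theta>. ?Q \<theta>"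
      using U ext by (simp add: universal_central_extension_def)
    moreover have "?Q (restrict (\<eta> \<circ> \<pi>) (carrier U))"
      using \<pi> \<eta> by (auto simp: hom_def Pi_iff)
    moreover have "?Q (restrict (\<lambda>x. x) (carrier U))"
      by (auto simp: hom_def)
    ultimately have eq: "restrict (\<eta> \<circ> \<pi>) (carrier U) = restrict (\<lambda>x. x) (carrier U)"
      by blast
    have "x = \<one>\<^bsub>U\<^esub>" if x: "x \<in> kernel U G \<pi>" for x
    proof -
      have "x = \<eta> (\<pi> x)"
        using fun_cong[OF eq, of x] x by (simp add: kernel_def)
      also have "\<dots> = \<one>\<^bsub>U\<^esub>"
        using x hom_one[OF \<eta>(1) G Ug] by (simp add: kernel_def)
      finally show ?thesis .
    qed
    then have "kernel U G \<pi> = {\<one>\<^bsub>U\<^esub>}"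
      by (auto simp: kernel_def)
    then show "trivial_group M"
      using \<pi>.subgroup_kernel M by (simp add: trivial_group_def \<pi>.G.subgroup_imp_group)
  qed
qed


section \<open>Groups given by generators and relations\<close>

abbreviation word_class :: "'x set \<Rightarrow> 'x word rel \<Rightarrow> 'x word \<Rightarrow> 'x word set" where
  "word_class X R w \<equiv> word_equiv X R `` {w}"

lemma words_over_simps [simp]:
  "[] \<in> words_over X"
  "p # w \<in> words_over X \<longleftrightarrow> fst p \<in> X \<and> w \<in> words_over X"
  "v @ w \<in> words_over X \<longleftrightarrow> v \<in> words_over X \<and> w \<in> words_over X"
  by (auto simp: words_over_def mem_Times_iff)

lemma word_inv_simps [simp]:
  "word_inv [] = []"
  "word_inv (p # w) = word_inv w @ [(fst p, \<not> snd p)]"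
  by (auto simp: word_inv_def split: prod.split)

lemma word_inv_words [simp]: "word_inv w \<in> words_over X \<longleftrightarrow> w \<in> words_over X"
  by (induction w) auto

lemma word_comm_words [simp]:
  "word_comm v w \<in> words_over X \<longleftrightarrow> v \<in> words_over X \<and> w \<in> words_over X"
  by (auto simp: word_comm_def)

lemma word_equiv_words:
  "(v, w) \<in> word_equiv X R \<Longrightarrow> v \<in> words_over X \<and> w \<in> words_over X"
  by (induction rule: word_equiv.induct) auto

lemma equiv_word_equiv: "equiv (words_over X) (word_equiv X R)"
proof (rule equivI)
  show "word_equiv X R \<subseteq> words_over X \<times> words_over X"
    using word_equiv_words by auto
  show "refl_on (words_over X) (word_equiv X R)"
    by (auto simp: refl_on_def intro: word_equiv.refl)
  show "Relation.sym (word_equiv X R)"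
    by (blast intro: symI word_equiv.sym)
  show "Relation.trans (word_equiv X R)"
    by (blast intro: transI word_equiv.trans)
qed

lemma word_class_eq_iff:
  "\<lbrakk>v \<in> words_over X; w \<in> words_over X\<rbrakk>
    \<Longrightarrow> word_class X R v = word_class X R w \<longleftrightarrow> (v, w) \<in> word_equiv X R"
  using eq_equiv_class_iff[OF equiv_word_equiv] by blast

lemma word_class_self: "w \<in> words_over X \<Longrightarrow> w \<in> word_class X R w"
  by (simp add: word_equiv.refl)

lemma presented_group_carrierE:
  assumes "P \<in> carrier (presented_group X R)"
  obtains w where "w \<in> words_over X" "P = word_class X R w"
  using assms by (auto simp: presented_group_def elim: quotientE)

lemma word_class_closed [simp]:
  "w \<in> words_over X \<Longrightarrow> word_class X R w \<in> carrier (presented_group X R)"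
  by (simp add: presented_group_def quotientI)

lemma word_class_mult:
  assumes "v \<in> words_over X" "w \<in> words_over X"
  shows "word_class X R v \<otimes>\<^bsub>presented_group X R\<^esub> word_class X R w = word_class X R (v @ w)"
proof -
  have "congruent2 (word_equiv X R) (word_equiv X R) (\<lambda>v w. word_class X R (v @ w))"
    by (auto simp: congruent2_def intro!: equiv_class_eq[OF equiv_word_equiv] word_equiv.append)
  from UN_equiv_class2[OF equiv_word_equiv equiv_word_equiv this assms] show ?thesis
    by (simp add: presented_group_def)
qed

lemma word_class_one: "\<one>\<^bsub>presented_group X R\<^esub> = word_class X R []"
  by (simp add: presented_group_def)

lemma word_inv_append: "w \<in> words_over X \<Longrightarrow> (word_inv w @ w, []) \<in> word_equiv X R"
proof (induction w)
  case (Cons p w)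
  obtain x b where p: "p = (x, b)" by (cases p)
  have "(word_inv w @ ([(x, \<not> b), (x, \<not> \<not> b)] @ w), word_inv w @ ([] @ w)) \<in> word_equiv X R"
    using Cons.prems p by (intro word_equiv.append word_equiv.refl word_equiv.cancel) auto
  with Cons p show ?case
    by (auto intro: word_equiv.trans)
qed (simp add: word_equiv.refl)

lemma group_presented_group: "group (presented_group X R)"
proof (rule groupI)
  fix P Q S
  assume "P \<in> carrier (presented_group X R)" "Q \<in> carrier (presented_group X R)"
    "S \<in> carrier (presented_group X R)"
  then show "P \<otimes>\<^bsub>presented_group X R\<^esub> Q \<otimes>\<^bsub>presented_group X R\<^esub> S
      = P \<otimes>\<^bsub>presented_group X R\<^esub> (Q \<otimes>\<^bsub>presented_group X R\<^esub> S)"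
    by (elim presented_group_carrierE) (simp add: word_class_mult)
next
  fix P
  assume "P \<in> carrier (presented_group X R)"
  then obtain w where w: "w \<in> words_over X" "P = word_class X R w"
    by (rule presented_group_carrierE)
  then have "word_class X R (word_inv w) \<otimes>\<^bsub>presented_group X R\<^esub> P = \<one>\<^bsub>presented_group X R\<^esub>"
    by (simp add: word_class_mult word_class_one word_class_eq_iff word_inv_append)
  with w show "\<exists>Q\<in>carrier (presented_group X R). Q \<otimes>\<^bsub>presented_group X R\<^esub> P = \<one>\<^bsub>presented_group X R\<^esub>"
    by (intro bexI[of _ "word_class X R (word_inv w)"]) simp_all
qed (auto elim!: presented_group_carrierE simp: word_class_mult word_class_one)

lemma word_class_inv:
  assumes w: "w \<in> words_over X"
  shows "inv\<^bsub>presented_group X R\<^esub> word_class X R w = word_class X R (word_inv w)"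
proof -
  interpret group "presented_group X R"
    by (rule group_presented_group)
  show ?thesis
    using w
    by (intro inv_equality) (simp_all add: word_class_mult word_class_one word_class_eq_iff word_inv_append)
qed

lemma word_class_comm:
  "\<lbrakk>v \<in> words_over X; w \<in> words_over X\<rbrakk> \<Longrightarrow>
    comm (presented_group X R) (word_class X R v) (word_class X R w) = word_class X R (word_comm v w)"
  by (simp add: comm_def word_comm_def word_class_inv word_class_mult)

lemma word_class_relation:
  "\<lbrakk>(v, w) \<in> R; v \<in> words_over X; w \<in> words_over X\<rbrakk> \<Longrightarrow> word_class X R v = word_class X R w"
  by (simp add: word_class_eq_iff word_equiv.relation)

lemma presented_group_generate:
  "carrier (presented_group X R)
    \<subseteq> generate (presented_group X R) ((\<lambda>x. word_class X R [(x, True)]) ` X)"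
    (is "_ \<subseteq> generate ?G ?S")
proof
  fix P
  assume "P \<in> carrier ?G"
  then obtain w where "w \<in> words_over X" "P = word_class X R w"
    by (rule presented_group_carrierE)
  moreover have "word_class X R w \<in> generate ?G ?S" if "w \<in> words_over X" for w
    using that
  proof (induction w)
    case Nil
    then show ?case
      using generate.one[of ?G ?S] by (simp add: word_class_one)
  next
    case (Cons p w)
    obtain x b where p: "p = (x, b)" by (cases p)
    have x: "x \<in> X"
      using Cons.prems p by simp
    have "word_class X R [(x, b)] \<in> generate ?G ?S"
    proof (cases b)
      case True
      then show ?thesis
        using x by (auto intro: generate.incl)
    next
      case False
      then show ?thesis
        using generate.inv[of "word_class X R [(x, True)]" ?S ?G] x
        by (simp add: word_class_inv)
    qed
    then have "word_class X R [(x, b)] \<otimes>\<^bsub>?G\<^esub> word_class X R w \<in> generate ?G ?S"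
      using Cons by (intro generate.eng) auto
    then show ?case
      using Cons.prems p by (simp add: word_class_mult)
  qed
  ultimately show "P \<in> generate ?G ?S"
    by simp
qed

fun word_eval :: "('h, 'm) monoid_scheme \<Rightarrow> ('x \<Rightarrow> 'h) \<Rightarrow> 'x word \<Rightarrow> 'h" where
  "word_eval H f [] = \<one>\<^bsub>H\<^esub>"
| "word_eval H f ((x, b) # w) = (if b then f x else inv\<^bsub>H\<^esub> f x) \<otimes>\<^bsub>H\<^esub> word_eval H f w"

context group
begin

lemma word_eval_closed [simp]:
  "\<lbrakk>f ` X \<subseteq> carrier G; w \<in> words_over X\<rbrakk> \<Longrightarrow> word_eval G f w \<in> carrier G"
proof (induction w)
  case (Cons p w)
  obtain x b where p: "p = (x, b)" by (cases p)
  then have "f x \<in> carrier G"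
    using Cons.prems by auto
  then show ?case
    using Cons p by simp
qed simp

lemma word_eval_append:
  "\<lbrakk>f ` X \<subseteq> carrier G; v \<in> words_over X; w \<in> words_over X\<rbrakk>
    \<Longrightarrow> word_eval G f (v @ w) = word_eval G f v \<otimes> word_eval G f w"
proof (induction v)
  case (Cons p v)
  obtain x b where p: "p = (x, b)" by (cases p)
  then have "f x \<in> carrier G" "word_eval G f v \<in> carrier G" "word_eval G f w \<in> carrier G"
    using Cons.prems word_eval_closed[of f X] by auto
  then show ?case
    using Cons p by (simp add: m_assoc)
qed (simp add: word_eval_closed[of f X])

lemma word_eval_inv:
  "\<lbrakk>f ` X \<subseteq> carrier G; w \<in> words_over X\<rbrakk> \<Longrightarrow> word_eval G f (word_inv w) = inv (word_eval G f w)"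
proof (induction w)
  case (Cons p w)
  obtain x b where p: "p = (x, b)" by (cases p)
  then have "f x \<in> carrier G" "word_eval G f w \<in> carrier G"
    using Cons.prems word_eval_closed[of f X] by auto
  then show ?case
    using Cons p word_eval_append[of f X "word_inv w" "[(x, \<not> b)]"]
    by (simp add: inv_mult_group)
qed simp

lemma word_eval_comm:
  assumes "f ` X \<subseteq> carrier G" "v \<in> words_over X" "w \<in> words_over X"
  shows "word_eval G f (word_comm v w) = comm G (word_eval G f v) (word_eval G f w)"
proof -
  have "word_eval G f v \<in> carrier G" "word_eval G f w \<in> carrier G"
    using assms word_eval_closed[of f X] by auto
  then show ?thesis
    using assms by (simp add: word_comm_def word_eval_append[of f X] word_eval_inv[of f X] comm_def m_assoc)
qed

text \<open>
  Extend \<open>f\<close> to words; by \<open>rel\<close> the value only depends on the class of a word.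
\<close>

lemma presented_group_hom:
  assumes f: "f ` X \<subseteq> carrier G"
    and rel: "\<And>v w. \<lbrakk>(v, w) \<in> R; v \<in> words_over X; w \<in> words_over X\<rbrakk>
      \<Longrightarrow> word_eval G f v = word_eval G f w"
  shows "\<exists>h\<in>hom (presented_group X R) G. \<forall>x\<in>X. h (word_class X R [(x, True)]) = f x"
proof -
  have eq: "word_eval G f v = word_eval G f w" if "(v, w) \<in> word_equiv X R" for v w
    using that
  proof (induction rule: word_equiv.induct)
    case (append v v' w w')
    then show ?case
      using word_equiv_words[OF append.hyps(1)] word_equiv_words[OF append.hyps(2)]
      by (simp add: word_eval_append[OF f])
  next
    case (cancel x b)
    then have "f x \<in> carrier G"
      using f by auto
    then show ?case by simp
  next
    case (relation v w)
    then show ?case by (rule rel)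
  qed simp_all
  define h where "h P = word_eval G f (SOME w. w \<in> P)" for P
  have h: "h (word_class X R w) = word_eval G f w" if "w \<in> words_over X" for w
  proof -
    have "(SOME v. v \<in> word_class X R w) \<in> word_class X R w"
      using word_class_self[OF that] by (rule someI)
    then show ?thesis
      using eq by (simp add: h_def)
  qed
  have "h \<in> hom (presented_group X R) G"
    using f by (auto intro!: homI elim!: presented_group_carrierE
        simp: h word_class_mult word_eval_append[OF f] word_eval_closed[OF f])
  moreover have "h (word_class X R [(x, True)]) = f x" if "x \<in> X" for x
    using that f by (simp add: h image_subset_iff)
  ultimately show ?thesis by blast
qed

end


section \<open>Odd unitary Steinberg groups of finite rank\<close>

context odd_quadratic_space
begin

lemma steinberg_gens_simps [simp]:
  "Short i j a \<in> steinberg_gens n \<longleftrightarrow> i \<in> Omega n \<and> j \<in> Omega n \<and> apart i j"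
  "Long i \<xi> \<in> steinberg_gens n \<longleftrightarrow> i \<in> Omega n \<and> \<xi> \<in> L"
  unfolding steinberg_gens_def apart_def[symmetric] by (auto simp del: split_paired_Ex)

definition stu_class :: "nat \<Rightarrow> ('v, 'r) steinberg_gen word \<Rightarrow> ('v, 'r) steinberg_gen word set" where
  "stu_class n w = word_class (steinberg_gens n) steinberg_rels w"

abbreviation stu_short :: "nat \<Rightarrow> int \<Rightarrow> int \<Rightarrow> 'r \<Rightarrow> ('v, 'r) steinberg_gen word set" where
  "stu_short n i j a \<equiv> stu_class n (XS i j a)"

abbreviation stu_long :: "nat \<Rightarrow> int \<Rightarrow> 'v \<times> 'r \<Rightarrow> ('v, 'r) steinberg_gen word set" where
  "stu_long n i \<xi> \<equiv> stu_class n (XL i \<xi>)"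

lemma Omega_uminus [simp]: "- i \<in> Omega n \<longleftrightarrow> i \<in> Omega n" "0 \<notin> Omega n"
  by (auto simp: Omega_def)

lemma stu_mult:
  assumes "v \<in> words_over (steinberg_gens n)" "w \<in> words_over (steinberg_gens n)"
  shows "stu_class n v \<otimes>\<^bsub>StU n\<^esub> stu_class n w = stu_class n (v @ w)"
  using assms by (simp add: stu_class_def StU_def word_class_mult)

lemma stu_comm:
  assumes "v \<in> words_over (steinberg_gens n)" "w \<in> words_over (steinberg_gens n)"
  shows "comm (StU n) (stu_class n v) (stu_class n w) = stu_class n (word_comm v w)"
  using assms by (simp add: stu_class_def StU_def word_class_comm)

lemma stu_closed [simp]: "w \<in> words_over (steinberg_gens n) \<Longrightarrow> stu_class n w \<in> carrier (StU n)"
  by (simp add: stu_class_def StU_def)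

lemma stu_relation:
  "\<lbrakk>(v, w) \<in> steinberg_rels; v \<in> words_over (steinberg_gens n); w \<in> words_over (steinberg_gens n)\<rbrakk>
    \<Longrightarrow> stu_class n v = stu_class n w"
  by (simp add: stu_class_def word_class_relation)

lemma stu_commute:
  assumes "(word_comm v w, []) \<in> steinberg_rels"
    and "v \<in> words_over (steinberg_gens n)" "w \<in> words_over (steinberg_gens n)"
  shows "stu_class n v \<otimes>\<^bsub>StU n\<^esub> stu_class n w = stu_class n w \<otimes>\<^bsub>StU n\<^esub> stu_class n v"
proof -
  interpret group "StU n"
    unfolding StU_def by (rule group_presented_group)
  have "comm (StU n) (stu_class n v) (stu_class n w) = \<one>\<^bsub>StU n\<^esub>"
    using stu_relation[OF assms(1), of n] assms(2,3)
    by (simp add: stu_comm) (simp add: stu_class_def StU_def word_class_one)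
  then show ?thesis
    using assms(2,3) by (simp add: comm_one_iff)
qed

lemma heisenberg_mult: "(u, a) \<otimes>\<^bsub>heisenberg\<^esub> (v, b) = (u + v, a + b + B u v)"
  by (simp add: heisenberg_def)

lemma StU_family: "steinberg_family bar act B L (StU n) (Omega n) (stu_short n) (stu_long n)"
proof -
  interpret group "StU n"
    unfolding StU_def by (rule group_presented_group)
  show ?thesis
  proof unfold_locales
    fix i j :: int and a b
    assume ij: "i \<in> Omega n" "j \<in> Omega n" "apart i j"
    show "stu_short n i j a = stu_short n (- j) (- i) (eps (- j) * bar a * eps i)"
      by (rule stu_relation[OF R0]) (use ij in auto)
    show "stu_short n i j a \<otimes>\<^bsub>StU n\<^esub> stu_short n i j b = stu_short n i j (a + b)"
      using stu_relation[OF R1[of i j a b], of n] ij by (simp add: stu_mult)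
    show "comm (StU n) (stu_short n i j a) (stu_short n j (- i) b)
      = stu_long n i (0, - eps (- i) * bar 1 * a * b + bar b * bar_inv * bar a * eps i)"
    proof -
      have "i \<noteq> 0" using ij by auto
      from L_opposite[OF this, of a b] show ?thesis
        using stu_relation[OF R9[of i j a b], of n] ij by (simp add: stu_comm)
    qed
  next
    fix i j k :: int and a b
    assume "i \<in> Omega n" "j \<in> Omega n" "k \<in> Omega n" "apart i j" "apart j k" "apart i k"
    then show "comm (StU n) (stu_short n i j a) (stu_short n j k b) = stu_short n i k (a * b)"
      using stu_relation[OF R5[of i j a k b], of n] by (simp add: stu_comm)
  next
    fix i j h k :: int and a b
    assume "i \<in> Omega n" "j \<in> Omega n" "apart i j" "h \<in> Omega n" "k \<in> Omega n" "apart h k"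
      "h \<noteq> j" "h \<noteq> - i" "k \<noteq> i" "k \<noteq> - j"
    then show "stu_short n i j a \<otimes>\<^bsub>StU n\<^esub> stu_short n h k b = stu_short n h k b \<otimes>\<^bsub>StU n\<^esub> stu_short n i j a"
      by (intro stu_commute R3) auto
  next
    fix i j k :: int and \<xi> a
    assume "i \<in> Omega n" "\<xi> \<in> L" "j \<in> Omega n" "k \<in> Omega n" "apart j k" "j \<noteq> - i" "k \<noteq> i"
    then show "stu_long n i \<xi> \<otimes>\<^bsub>StU n\<^esub> stu_short n j k a = stu_short n j k a \<otimes>\<^bsub>StU n\<^esub> stu_long n i \<xi>"
      by (intro stu_commute R4) auto
  next
    fix i :: int and u a v b
    assume i: "i \<in> Omega n" "(u, a) \<in> L" "(v, b) \<in> L"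
    then show "stu_long n i (u, a) \<otimes>\<^bsub>StU n\<^esub> stu_long n i (v, b) = stu_long n i (u + v, a + b + B u v)"
      using stu_relation[OF R2[of i "(u, a)" "(v, b)"], of n] L_mult[of u a v b]
      by (simp add: stu_mult heisenberg_mult)
    show "comm (StU n) (stu_long n i (u, a)) (stu_long n i (v, b)) = stu_long n i (0, B u v - B v u)"
      using stu_relation[OF R7[of i u a v b], of n] L_form[of u v] i by (simp add: stu_comm)
  next
    fix i j :: int and u a v b
    assume "i \<in> Omega n" "j \<in> Omega n" "apart i j" "(u, a) \<in> L" "(v, b) \<in> L"
    then show "comm (StU n) (stu_long n i (u, a)) (stu_long n j (v, b)) = stu_short n i (- j) (eps i * B u v)"
      using stu_relation[OF R6[of i j u a v b, folded apart_def], of n] by (simp add: stu_comm)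
  next
    fix i j :: int and u a b
    assume ij: "i \<in> Omega n" "j \<in> Omega n" "apart i j" and L: "(u, a) \<in> L"
    then show "comm (StU n) (stu_long n i (u, a)) (stu_short n (- i) j b)
        = stu_short n i j (eps i * a * b) \<otimes>\<^bsub>StU n\<^esub> stu_long n (- j) (heis_act (u, - bar a) b)"
      using stu_relation[OF R8[of i u a j b], of n] L_act[OF L_dual[OF L], of b]
      by (simp add: stu_comm stu_mult)
  qed auto
qed

lemma StU_generate:
  "carrier (StU n) \<subseteq> generate (StU n) (steinberg_family.generators L (Omega n) (stu_short n) (stu_long n))"
proof -
  interpret steinberg_family bar act B L "StU n" "Omega n" "stu_short n" "stu_long n"
    by (rule StU_family)
  have "stu_class n [(x, True)] \<in> generators" if "x \<in> steinberg_gens n" for x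
    using that by (cases x) (auto simp: generators_def simp del: split_paired_Ex)
  then have "(\<lambda>x. stu_class n [(x, True)]) ` steinberg_gens n \<subseteq> generators"
    by blast
  from mono_generate[OF this] show ?thesis
    using presented_group_generate[of "steinberg_gens n" steinberg_rels]
    by (simp add: StU_def stu_class_def)
qed

lemma StU_universal:
  assumes "steinberg_family bar act B L H (Omega n) ys yl"
  shows "\<exists>h\<in>hom (StU n) H. (\<forall>i\<in>Omega n. \<forall>j\<in>Omega n. \<forall>a. apart i j \<longrightarrow> h (stu_short n i j a) = ys i j a)
      \<and> (\<forall>i\<in>Omega n. \<forall>\<xi>\<in>L. h (stu_long n i \<xi>) = yl i \<xi>)"
proof -
  interpret H: steinberg_family bar act B L H "Omega n" ys yl
    by (rule assms)
  define f where "f = case_steinberg_gen ys yl"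
  have f_simps: "f (Short i j a) = ys i j a" "f (Long i \<xi>) = yl i \<xi>" for i j a \<xi>
    by (simp_all add: f_def)
  have f: "f ` steinberg_gens n \<subseteq> carrier H"
  proof
    fix y
    assume "y \<in> f ` steinberg_gens n"
    then obtain x where "x \<in> steinberg_gens n" "y = f x"
      by blast
    then show "y \<in> carrier H"
      by (cases x) (auto simp: f_simps H.xs_closed H.xl_closed)
  qed
  note eval = H.word_eval_comm[OF f] H.word_eval_append[OF f]
  have "word_eval H f v = word_eval H f w"
    if rel: "(v, w) \<in> steinberg_rels"
      and v: "v \<in> words_over (steinberg_gens n)" and w: "w \<in> words_over (steinberg_gens n)" for v w
    using rel
  proof cases
    case (R0 i j a)
    then show ?thesis
      using v H.R0[of i j a] by (simp add: f_simps)
  next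
    case (R1 i j a b)
    then show ?thesis
      using v H.R1[of i j a b] by (simp add: f_simps H.xs_closed)
  next
    case (R2 i \<xi> \<zeta>)
    then show ?thesis
      using v w H.R2[of i] by (cases \<xi>; cases \<zeta>) (simp add: f_simps H.xl_closed heisenberg_mult)
  next
    case (R3 h j i k a b)
    then show ?thesis
      using v H.R3[of i j h k a b] by (simp add: f_simps eval H.xs_closed H.comm_one_iff)
  next
    case (R4 j i k \<xi> a)
    then show ?thesis
      using v H.R4[of i \<xi> j k a] by (simp add: f_simps eval H.xs_closed H.xl_closed H.comm_one_iff)
  next
    case (R5 i j a k b)
    then show ?thesis
      using v w H.R5[of i j k a b] by (simp add: f_simps eval H.xs_closed)
  next
    case (R6 i j u a v' b)
    then show ?thesis
      using v w H.R6[of i j u a v' b] by (simp add: f_simps eval H.xs_closed H.xl_closed)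
  next
    case (R7 i u a v' b)
    then show ?thesis
      using v w H.R7[of i u a v' b] by (simp add: f_simps eval H.xl_closed)
  next
    case (R8 i u a j b)
    then show ?thesis
      using v w H.R8[of i j u a b] by (simp add: f_simps eval H.xs_closed H.xl_closed)
  next
    case (R9 i j a b)
    then show ?thesis
      using v w H.R9[of i j a b] by (simp add: f_simps eval H.xs_closed H.xl_closed)
  qed
  from H.presented_group_hom[OF f this] obtain h
    where h: "h \<in> hom (StU n) H"
      "\<And>x. x \<in> steinberg_gens n \<Longrightarrow> h (word_class (steinberg_gens n) steinberg_rels [(x, True)]) = f x"
    unfolding StU_def by blast
  then show ?thesis
    by (intro bexI[of _ h]) (auto simp: stu_class_def f_simps)
qed

lemma StU_schur_multiplier_trivial:
  assumes "5 \<le> n"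
  shows "schur_multiplier_trivial TYPE('h) (StU n)"
proof (rule schur_multiplier_trivialI[OF StU_family])
  show "{1..5} \<subseteq> Omega n"
    using assms by (auto simp: Omega_def)
qed (rule StU_generate StU_universal; assumption?)+

end


section \<open>Direct limits\<close>

locale group_sequence =
  fixes m :: nat and G :: "nat \<Rightarrow> 'g monoid" and f :: "nat \<Rightarrow> 'g \<Rightarrow> 'g"
  assumes groups: "m \<le> i \<Longrightarrow> group (G i)"
    and step_hom: "m \<le> i \<Longrightarrow> f i \<in> hom (G i) (G (Suc i))"
begin

abbreviation transition :: "nat \<Rightarrow> nat \<Rightarrow> 'g \<Rightarrow> 'g" where
  "transition i k \<equiv> fold f [i..<k]"

abbreviation limit :: "(nat \<times> 'g) set monoid" where
  "limit \<equiv> direct_limit m G f"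

definition inj_limit :: "nat \<Rightarrow> 'g \<Rightarrow> (nat \<times> 'g) set" where
  "inj_limit i x = direct_limit_rel m G f `` {(i, x)}"

lemma transition_hom: "\<lbrakk>m \<le> i; i \<le> k\<rbrakk> \<Longrightarrow> transition i k \<in> hom (G i) (G k)"
proof (induction k)
  case (Suc k)
  show ?case
  proof (cases "i = Suc k")
    case True
    then show ?thesis by (simp add: hom_def)
  next
    case False
    with Suc have "f k \<circ> transition i k \<in> hom (G i) (G (Suc k))"
      by (intro hom_compose[OF _ step_hom]) auto
    then show ?thesis
      using False Suc by (simp add: comp_def)
  qed
qed (simp add: hom_def)

lemma transition_closed: "\<lbrakk>m \<le> i; i \<le> k; x \<in> carrier (G i)\<rbrakk> \<Longrightarrow> transition i k x \<in> carrier (G k)"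
  using transition_hom by (auto simp: hom_def)

lemma transition_comp: "\<lbrakk>i \<le> j; j \<le> k\<rbrakk> \<Longrightarrow> transition j k (transition i j x) = transition i k x"
  by (metis comp_apply fold_append le_add_diff_inverse upt_add_eq_append)

lemma rel_iff:
  "((i, x), (j, y)) \<in> direct_limit_rel m G f \<longleftrightarrow>
    m \<le> i \<and> x \<in> carrier (G i) \<and> m \<le> j \<and> y \<in> carrier (G j) \<and>
    (\<exists>k. i \<le> k \<and> j \<le> k \<and> transition i k x = transition j k y)"
  by (simp add: direct_limit_rel_def)

lemma equiv_rel: "equiv (SIGMA i:{m..}. carrier (G i)) (direct_limit_rel m G f)"
proof (rule equivI)
  show "direct_limit_rel m G f \<subseteq> (SIGMA i:{m..}. carrier (G i)) \<times> (SIGMA i:{m..}. carrier (G i))"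
    by (auto simp: direct_limit_rel_def)
  show "refl_on (SIGMA i:{m..}. carrier (G i)) (direct_limit_rel m G f)"
    by (auto simp: refl_on_def rel_iff)
  show "Relation.sym (direct_limit_rel m G f)"
  proof (rule symI)
    fix p q
    assume "(p, q) \<in> direct_limit_rel m G f"
    then show "(q, p) \<in> direct_limit_rel m G f"
      by (cases p; cases q) (auto simp: rel_iff intro: HOL.sym)
  qed
  show "Relation.trans (direct_limit_rel m G f)"
  proof (rule transI)
    fix p q r
    assume "(p, q) \<in> direct_limit_rel m G f" "(q, r) \<in> direct_limit_rel m G f"
    moreover obtain i x j y l z where pqr: "p = (i, x)" "q = (j, y)" "r = (l, z)"
      by (cases p; cases q; cases r)
    ultimately obtain k k' where k: "i \<le> k" "j \<le> k" "transition i k x = transition j k y"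
      and k': "j \<le> k'" "l \<le> k'" "transition j k' y = transition l k' z"
      and mem: "m \<le> i" "x \<in> carrier (G i)" "m \<le> l" "z \<in> carrier (G l)"
      by (auto simp: rel_iff)
    have "transition i (max k k') x = transition k (max k k') (transition i k x)"
      using k(1,2) by (simp add: transition_comp)
    also have "\<dots> = transition k' (max k k') (transition j k' y)"
      using k k'(1,2) by (simp add: transition_comp)
    also have "\<dots> = transition l (max k k') z"
      using k' by (simp add: transition_comp)
    finally show "(p, r) \<in> direct_limit_rel m G f"
      using k k' mem by (auto simp: pqr rel_iff intro!: exI[of _ "max k k'"])
  qed
qed

lemma inj_limit_eq_iff:
  assumes "m \<le> i" "x \<in> carrier (G i)" "m \<le> j" "y \<in> carrier (G j)"
  shows "inj_limit i x = inj_limit j y \<longleftrightarrow>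
    (\<exists>k. i \<le> k \<and> j \<le> k \<and> transition i k x = transition j k y)"
  using eq_equiv_class_iff[OF equiv_rel, of "(i, x)" "(j, y)"] assms
  by (auto simp: inj_limit_def rel_iff)

lemma inj_limit_transition:
  assumes "m \<le> i" "i \<le> k" "x \<in> carrier (G i)"
  shows "inj_limit k (transition i k x) = inj_limit i x"
  using assms transition_closed by (subst inj_limit_eq_iff) auto

lemma inj_limit_closed: "\<lbrakk>m \<le> i; x \<in> carrier (G i)\<rbrakk> \<Longrightarrow> inj_limit i x \<in> carrier limit"
  by (auto simp: direct_limit_def inj_limit_def intro: quotientI)

lemma limit_carrierE:
  assumes "P \<in> carrier limit"
  obtains i x where "m \<le> i" "x \<in> carrier (G i)" "P = inj_limit i x"
  using assms by (auto simp: direct_limit_def inj_limit_def elim!: quotientE)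

lemma limit_carrier_above:
  assumes "P \<in> carrier limit"
  shows "\<exists>i\<ge>m. \<forall>k\<ge>i. \<exists>x\<in>carrier (G k). P = inj_limit k x"
proof -
  obtain i x where P: "m \<le> i" "x \<in> carrier (G i)" "P = inj_limit i x"
    using assms by (rule limit_carrierE)
  then have "\<exists>y\<in>carrier (G k). P = inj_limit k y" if "i \<le> k" for k
    using that inj_limit_transition transition_closed by blast
  with P show ?thesis by blast
qed

text \<open>
  The product in the limit is defined through the maximum of the two stages; at any later stage it is the
  same, which gives both its independence of the representatives and this formula.
\<close>

lemma limit_mult:
  assumes i: "m \<le> i" and x: "x \<in> carrier (G i)" and y: "y \<in> carrier (G i)"
  shows "inj_limit i x \<otimes>\<^bsub>limit\<^esub> inj_limit i y = inj_limit i (x \<otimes>\<^bsub>G i\<^esub> y)"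
proof -
  let ?F = "\<lambda>(j, a) (l, b). inj_limit (max j l)
    (transition j (max j l) a \<otimes>\<^bsub>G (max j l)\<^esub> transition l (max j l) b)"
  \<comment> \<open>the stage \<open>max j l\<close> may be replaced by any later one\<close>
  have F: "?F (j, a) (l, b) = inj_limit k (transition j k a \<otimes>\<^bsub>G k\<^esub> transition l k b)"
    if "m \<le> j" "a \<in> carrier (G j)" "m \<le> l" "b \<in> carrier (G l)" "j \<le> k" "l \<le> k" for j a l b k
  proof -
    let ?n = "max j l"
    have n: "m \<le> ?n" "j \<le> ?n" "l \<le> ?n" "?n \<le> k"
      using that by auto
    have ab: "transition j ?n a \<in> carrier (G ?n)" "transition l ?n b \<in> carrier (G ?n)"
      using n that by (auto intro!: transition_closed)
    then have "?F (j, a) (l, b)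
        = inj_limit k (transition ?n k (transition j ?n a \<otimes>\<^bsub>G ?n\<^esub> transition l ?n b))"
      using n groups[of ?n] by (simp add: inj_limit_transition group.is_monoid monoid.m_closed)
    also have "transition ?n k (transition j ?n a \<otimes>\<^bsub>G ?n\<^esub> transition l ?n b)
        = transition j k a \<otimes>\<^bsub>G k\<^esub> transition l k b"
      using Group.hom_mult[OF transition_hom[OF n(1,4)] ab] n by (simp add: transition_comp)
    finally show ?thesis .
  qed
  have "congruent2 (direct_limit_rel m G f) (direct_limit_rel m G f) ?F"
  proof (rule congruent2I')
    fix p p' q q'
    assume rel: "(p, p') \<in> direct_limit_rel m G f" "(q, q') \<in> direct_limit_rel m G f"
    obtain j a j' a' l b l' b' where pq: "p = (j, a)" "p' = (j', a')" "q = (l, b)" "q' = (l', b')"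
      by (cases p; cases p'; cases q; cases q')
    from rel obtain k k' where k: "j \<le> k" "j' \<le> k" "transition j k a = transition j' k a'"
      and k': "l \<le> k'" "l' \<le> k'" "transition l k' b = transition l' k' b'"
      and mem: "m \<le> j" "a \<in> carrier (G j)" "m \<le> j'" "a' \<in> carrier (G j')"
        "m \<le> l" "b \<in> carrier (G l)" "m \<le> l'" "b' \<in> carrier (G l')"
      by (auto simp: pq rel_iff)
    let ?n = "max k k'"
    have "transition j ?n a = transition j' ?n a'"
      using k transition_comp[of j k ?n a] transition_comp[of j' k ?n a'] by simp
    moreover have "transition l ?n b = transition l' ?n b'"
      using k' transition_comp[of l k' ?n b] transition_comp[of l' k' ?n b'] by simp
    ultimately show "?F p q = ?F p' q'"
      unfolding pq using F[of j a l b ?n] F[of j' a' l' b' ?n] k k' mem by simp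
  qed
  from UN_equiv_class2[OF equiv_rel equiv_rel this, of "(i, x)" "(i, y)"] show ?thesis
    using assms by (simp add: direct_limit_def inj_limit_def case_prod_unfold)
qed

lemma limit_one: "m \<le> i \<Longrightarrow> inj_limit i \<one>\<^bsub>G i\<^esub> = \<one>\<^bsub>limit\<^esub>"
  using inj_limit_transition[of m i "\<one>\<^bsub>G m\<^esub>"] hom_one[OF transition_hom[of m i] groups groups] groups[of m]
  by (simp add: direct_limit_def inj_limit_def group.is_monoid monoid.one_closed)

lemma group_limit: "group limit"
proof (rule groupI)
  fix P Q S
  assume "P \<in> carrier limit" "Q \<in> carrier limit" "S \<in> carrier limit"
  then obtain i j l where i: "m \<le> i" "\<forall>k\<ge>i. \<exists>x\<in>carrier (G k). P = inj_limit k x"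
    and j: "\<forall>k\<ge>j. \<exists>x\<in>carrier (G k). Q = inj_limit k x"
    and l: "\<forall>k\<ge>l. \<exists>x\<in>carrier (G k). S = inj_limit k x"
    using limit_carrier_above[of P] limit_carrier_above[of Q] limit_carrier_above[of S] by blast
  define n where "n = max i (max j l)"
  have "i \<le> n" "j \<le> n" "l \<le> n" by (auto simp: n_def)
  then obtain x y z where xyz: "x \<in> carrier (G n)" "y \<in> carrier (G n)" "z \<in> carrier (G n)"
    and PQS: "P = inj_limit n x" "Q = inj_limit n y" "S = inj_limit n z"
    using i(2)[rule_format, of n] j[rule_format, of n] l[rule_format, of n] by blast
  have n: "m \<le> n"
    using i(1) \<open>i \<le> n\<close> by simp
  interpret Gn: group "G n"
    by (rule groups[OF n])
  show "P \<otimes>\<^bsub>limit\<^esub> Q \<in> carrier limit"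
    using n xyz by (simp add: PQS limit_mult inj_limit_closed)
  show "P \<otimes>\<^bsub>limit\<^esub> Q \<otimes>\<^bsub>limit\<^esub> S = P \<otimes>\<^bsub>limit\<^esub> (Q \<otimes>\<^bsub>limit\<^esub> S)"
    using n xyz by (simp add: PQS limit_mult Gn.m_assoc)
next
  show "\<one>\<^bsub>limit\<^esub> \<in> carrier limit"
    using limit_one[of m] inj_limit_closed[of m "\<one>\<^bsub>G m\<^esub>"] groups[of m]
    by (simp add: group.is_monoid monoid.one_closed)
next
  fix P
  assume "P \<in> carrier limit"
  then obtain i x where i: "m \<le> i" and x: "x \<in> carrier (G i)" "P = inj_limit i x"
    by (rule limit_carrierE)
  interpret Gi: group "G i"
    by (rule groups[OF i])
  show "\<one>\<^bsub>limit\<^esub> \<otimes>\<^bsub>limit\<^esub> P = P"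
    using i x by (simp add: limit_mult flip: limit_one[OF i])
  show "\<exists>Q\<in>carrier limit. Q \<otimes>\<^bsub>limit\<^esub> P = \<one>\<^bsub>limit\<^esub>"
    using i x by (intro bexI[of _ "inj_limit i (inv\<^bsub>G i\<^esub> x)"])
      (simp_all add: limit_mult inj_limit_closed limit_one)
qed

lemma inj_limit_hom: "m \<le> i \<Longrightarrow> inj_limit i \<in> hom (G i) limit"
  by (simp add: hom_def inj_limit_closed limit_mult)

lemma limit_hom:
  assumes h: "\<And>i. m \<le> i \<Longrightarrow> h i \<in> hom (G i) H"
    and compat: "\<And>i x. \<lbrakk>m \<le> i; x \<in> carrier (G i)\<rbrakk> \<Longrightarrow> h (Suc i) (f i x) = h i x"
  shows "\<exists>g\<in>hom limit H. \<forall>i\<ge>m. \<forall>x\<in>carrier (G i). g (inj_limit i x) = h i x"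
proof -
  have transition: "h k (transition i k x) = h i x" if "m \<le> i" "i \<le> k" "x \<in> carrier (G i)" for i k x
    using that(2)
  proof (induction k rule: dec_induct)
    case (step k)
    then show ?case
      using compat[of k "transition i k x"] transition_closed that by simp
  qed simp
  define g where "g P = (case SOME p. p \<in> P of (i, x) \<Rightarrow> h i x)" for P
  have g: "g (inj_limit i x) = h i x" if i: "m \<le> i" and x: "x \<in> carrier (G i)" for i x
  proof -
    obtain j y where jy: "(SOME p. p \<in> inj_limit i x) = (j, y)"
      by (cases "SOME p. p \<in> inj_limit i x")
    have "(i, x) \<in> inj_limit i x"
      using that by (auto simp: inj_limit_def rel_iff)
    then have "(j, y) \<in> inj_limit i x"
      unfolding jy[symmetric] by (rule someI)
    then obtain k where "i \<le> k" "j \<le> k" "transition i k x = transition j k y"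
      and "m \<le> j" "y \<in> carrier (G j)"
      by (auto simp: inj_limit_def rel_iff)
    then have "h i x = h j y"
      using transition[of i k x] transition[of j k y] that by simp
    then show ?thesis
      by (simp add: g_def jy)
  qed
  have "g \<in> hom limit H"
  proof (rule homI)
    fix P
    assume "P \<in> carrier limit"
    then show "g P \<in> carrier H"
      using g h by (elim limit_carrierE) (auto simp: hom_def)
  next
    fix P Q
    assume "P \<in> carrier limit" "Q \<in> carrier limit"
    then obtain i j where i: "m \<le> i" "\<forall>k\<ge>i. \<exists>x\<in>carrier (G k). P = inj_limit k x"
      and j: "\<forall>k\<ge>j. \<exists>x\<in>carrier (G k). Q = inj_limit k x"
      using limit_carrier_above[of P] limit_carrier_above[of Q] by blast
    then obtain x y where xy: "x \<in> carrier (G (max i j))" "y \<in> carrier (G (max i j))"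
      and PQ: "P = inj_limit (max i j) x" "Q = inj_limit (max i j) y"
      using i(2)[rule_format, OF max.cobounded1] j[rule_format, OF max.cobounded2] by blast
    have n: "m \<le> max i j"
      using i(1) by simp
    then show "g (P \<otimes>\<^bsub>limit\<^esub> Q) = g P \<otimes>\<^bsub>H\<^esub> g Q"
      using xy groups[OF n] Group.hom_mult[OF h[OF n] xy]
      by (simp add: PQ limit_mult g group.is_monoid monoid.m_closed)
  qed
  with g show ?thesis by blast
qed

end


section \<open>The odd unitary Steinberg group of infinite rank\<close>

lemma words_over_mono: "X \<subseteq> Y \<Longrightarrow> words_over X \<subseteq> words_over Y"
  by (auto simp: words_over_def)

lemma word_equiv_mono:
  assumes "X \<subseteq> Y"
  shows "(v, w) \<in> word_equiv X R \<Longrightarrow> (v, w) \<in> word_equiv Y R"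
proof (induction rule: word_equiv.induct)
  case (trans u v w)
  then show ?case by (blast intro: word_equiv.trans)
next
  case (cancel x b)
  then show ?case
    using assms by (blast intro: word_equiv.cancel)
qed (use words_over_mono[OF assms] in \<open>blast intro: word_equiv.intros\<close>)+

context odd_quadratic_space
begin

text \<open>
  Each relation involves at most four indices, all of which lie in \<open>Omega n\<close> for large \<open>n\<close>.
\<close>

lemma family_union:
  assumes fam: "\<And>n. 3 \<le> n \<Longrightarrow> steinberg_family bar act B L G (Omega n) xs xl"
  shows "steinberg_family bar act B L G (- {0}) xs xl"
proof -
  interpret group G
    using fam[of 3] by (simp add: steinberg_family_def)
  have "\<exists>n\<ge>3. i \<in> Omega n \<and> j \<in> Omega n \<and> h \<in> Omega n \<and> k \<in> Omega n"
    if "i \<in> - {0}" "j \<in> - {0}" "h \<in> - {0}" "k \<in> - {0}" for i j h k :: int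
    using that by (intro exI[of _ "nat (3 + \<bar>i\<bar> + \<bar>j\<bar> + \<bar>h\<bar> + \<bar>k\<bar>)"]) (auto simp: Omega_def)
  then have big: "\<exists>n. steinberg_family bar act B L G (Omega n) xs xl
      \<and> i \<in> Omega n \<and> j \<in> Omega n \<and> h \<in> Omega n \<and> k \<in> Omega n"
    if "i \<in> - {0}" "j \<in> - {0}" "h \<in> - {0}" "k \<in> - {0}" for i j h k :: int
    using that fam by meson
  show ?thesis
  proof unfold_locales
    fix i j :: int and a b
    assume ij: "i \<in> - {0}" "j \<in> - {0}" "apart i j"
    obtain n where n: "steinberg_family bar act B L G (Omega n) xs xl" "i \<in> Omega n" "j \<in> Omega n"
      using big[OF ij(1,2) ij(1,1)] by blast
    interpret F: steinberg_family bar act B L G "Omega n" xs xl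
      by (rule n)
    show "xs i j a \<in> carrier G" "xs i j a \<otimes>\<^bsub>G\<^esub> xs i j b = xs i j (a + b)"
      "xs i j a = xs (- j) (- i) (eps (- j) * bar a * eps i)"
      "comm G (xs i j a) (xs j (- i) b)
        = xl i (0, - eps (- i) * bar 1 * a * b + bar b * bar_inv * bar a * eps i)"
      using F.xs_closed F.R1 F.R0 F.R9 n ij by blast+
  next
    fix i :: int and \<xi>
    assume i: "i \<in> - {0}" "\<xi> \<in> L"
    obtain n where n: "steinberg_family bar act B L G (Omega n) xs xl" "i \<in> Omega n"
      using big[OF i(1) i(1) i(1) i(1)] by blast
    then show "xl i \<xi> \<in> carrier G"
      using steinberg_family.xl_closed i by blast
  next
    fix i :: int and u a v b
    assume i: "i \<in> - {0}" "(u, a) \<in> L" "(v, b) \<in> L"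
    obtain n where n: "steinberg_family bar act B L G (Omega n) xs xl" "i \<in> Omega n"
      using big[OF i(1) i(1) i(1) i(1)] by blast
    show "xl i (u, a) \<otimes>\<^bsub>G\<^esub> xl i (v, b) = xl i (u + v, a + b + B u v)"
      "comm G (xl i (u, a)) (xl i (v, b)) = xl i (0, B u v - B v u)"
      by (rule steinberg_family.R2[OF n i(2,3)] steinberg_family.R7[OF n i(2,3)])+
  next
    fix i j h k :: int and a b
    assume *: "i \<in> - {0}" "j \<in> - {0}" "apart i j" "h \<in> - {0}" "k \<in> - {0}" "apart h k"
      "h \<noteq> j" "h \<noteq> - i" "k \<noteq> i" "k \<noteq> - j"
    obtain n where n: "steinberg_family bar act B L G (Omega n) xs xl"
      "i \<in> Omega n" "j \<in> Omega n" "h \<in> Omega n" "k \<in> Omega n"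
      using big[OF *(1,2,4,5)] by blast
    show "xs i j a \<otimes>\<^bsub>G\<^esub> xs h k b = xs h k b \<otimes>\<^bsub>G\<^esub> xs i j a"
      by (rule steinberg_family.R3[OF n(1-3) *(3) n(4,5) *(6-10)])
  next
    fix i j k :: int and \<xi> a
    assume *: "i \<in> - {0}" "\<xi> \<in> L" "j \<in> - {0}" "k \<in> - {0}" "apart j k" "j \<noteq> - i" "k \<noteq> i"
    obtain n where n: "steinberg_family bar act B L G (Omega n) xs xl"
      "i \<in> Omega n" "j \<in> Omega n" "k \<in> Omega n"
      using big[OF *(1,1,3,4)] by blast
    show "xl i \<xi> \<otimes>\<^bsub>G\<^esub> xs j k a = xs j k a \<otimes>\<^bsub>G\<^esub> xl i \<xi>"
      by (rule steinberg_family.R4[OF n(1,2) *(2) n(3,4) *(5-7)])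
  next
    fix i j k :: int and a b
    assume *: "i \<in> - {0}" "j \<in> - {0}" "k \<in> - {0}" "apart i j" "apart j k" "apart i k"
    obtain n where n: "steinberg_family bar act B L G (Omega n) xs xl"
      "i \<in> Omega n" "j \<in> Omega n" "k \<in> Omega n"
      using big[OF *(1,1,2,3)] by blast
    show "comm G (xs i j a) (xs j k b) = xs i k (a * b)"
      by (rule steinberg_family.R5[OF n *(4-6)])
  next
    fix i j :: int and u a v b
    assume *: "i \<in> - {0}" "j \<in> - {0}" "apart i j" "(u, a) \<in> L" "(v, b) \<in> L"
    obtain n where n: "steinberg_family bar act B L G (Omega n) xs xl" "i \<in> Omega n" "j \<in> Omega n"
      using big[OF *(1,1,1,2)] by blast
    show "comm G (xl i (u, a)) (xl j (v, b)) = xs i (- j) (eps i * B u v)"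
      by (rule steinberg_family.R6[OF n *(3-5)])
  next
    fix i j :: int and u a b
    assume *: "i \<in> - {0}" "j \<in> - {0}" "apart i j" "(u, a) \<in> L"
    obtain n where n: "steinberg_family bar act B L G (Omega n) xs xl" "i \<in> Omega n" "j \<in> Omega n"
      using big[OF *(1,1,1,2)] by blast
    show "comm G (xl i (u, a)) (xs (- i) j b)
        = xs i j (eps i * a * b) \<otimes>\<^bsub>G\<^esub> xl (- j) (heis_act (u, - bar a) b)"
      by (rule steinberg_family.R8[OF n *(3,4)])
  qed auto
qed

lemma Omega_mono: "i \<le> k \<Longrightarrow> Omega i \<subseteq> Omega k"
  by (auto simp: Omega_def)

lemma steinberg_gens_mono: "i \<le> k \<Longrightarrow> steinberg_gens i \<subseteq> steinberg_gens k"
  using Omega_mono[of i k] by (auto simp: steinberg_gens_def)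

lemma StU_step_class:
  assumes w: "w \<in> words_over (steinberg_gens n)"
  shows "StU_step n (stu_class n w) = stu_class (Suc n) w"
proof -
  have sub: "steinberg_gens n \<subseteq> steinberg_gens (Suc n)"
    by (rule steinberg_gens_mono) simp
  have "stu_class (Suc n) v = stu_class (Suc n) w" if "v \<in> stu_class n w" for v
  proof -
    have "(w, v) \<in> word_equiv (steinberg_gens (Suc n)) steinberg_rels"
      using that word_equiv_mono[OF sub] by (simp add: stu_class_def)
    then show ?thesis
      unfolding stu_class_def by (rule equiv_class_eq[OF equiv_word_equiv, THEN HOL.sym])
  qed
  moreover have "w \<in> stu_class n w"
    unfolding stu_class_def using w by (rule word_class_self)
  ultimately show ?thesis
    unfolding StU_step_def by (subst stu_class_def[of "Suc n", symmetric]) blast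
qed

lemma StU_carrierE:
  assumes "P \<in> carrier (StU n)"
  obtains w where "w \<in> words_over (steinberg_gens n)" "P = stu_class n w"
  using assms unfolding StU_def stu_class_def by (rule presented_group_carrierE)

lemma StU_group: "group (StU n)"
  unfolding StU_def by (rule group_presented_group)

lemma StU_step_hom: "StU_step n \<in> hom (StU n) (StU (Suc n))"
proof -
  have sub: "w \<in> words_over (steinberg_gens (Suc n))" if "w \<in> words_over (steinberg_gens n)" for w
    using that words_over_mono[OF steinberg_gens_mono[of n "Suc n"]] by auto
  show ?thesis
    by (rule homI) (auto elim!: StU_carrierE simp: StU_step_class sub stu_mult)
qed

sublocale StU: group_sequence 3 StU StU_step
  by (rule group_sequence.intro) (simp_all add: StU_group StU_step_hom)

lemma StU_inf_limit: "StU_inf = StU.limit"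
  by (simp add: StU_inf_def)

lemma transition_class:
  assumes "w \<in> words_over (steinberg_gens i)" "i \<le> k"
  shows "StU.transition i k (stu_class i w) = stu_class k w"
  using assms(2)
proof (induction k rule: dec_induct)
  case (step k)
  moreover have "w \<in> words_over (steinberg_gens k)"
    using assms(1) words_over_mono[OF steinberg_gens_mono[OF step(1)]] by auto
  ultimately show ?case
    by (simp add: StU_step_class)
qed simp

text \<open>
  Any stage at which the indices are admissible would do; \<open>3\<close> is the first stage of the limit.
\<close>

definition inf_short :: "int \<Rightarrow> int \<Rightarrow> 'r \<Rightarrow> (nat \<times> ('v, 'r) steinberg_gen word set) set" where
  "inf_short i j a = (let n = 3 + nat \<bar>i\<bar> + nat \<bar>j\<bar> in StU.inj_limit n (stu_short n i j a))"

definition inf_long :: "int \<Rightarrow> 'v \<times> 'r \<Rightarrow> (nat \<times> ('v, 'r) steinberg_gen word set) set" where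
  "inf_long i \<xi> = (let n = 3 + nat \<bar>i\<bar> in StU.inj_limit n (stu_long n i \<xi>))"

lemma inj_limit_class:
  assumes "3 \<le> i" "3 \<le> k" "w \<in> words_over (steinberg_gens i)" "w \<in> words_over (steinberg_gens k)"
  shows "StU.inj_limit i (stu_class i w) = StU.inj_limit k (stu_class k w)"
  using StU.inj_limit_transition[of i "max i k" "stu_class i w"]
    StU.inj_limit_transition[of k "max i k" "stu_class k w"] assms
  by (simp add: transition_class)

lemma inf_short_eq:
  assumes "3 \<le> n" "i \<in> Omega n" "j \<in> Omega n" "apart i j"
  shows "inf_short i j a = StU.inj_limit n (stu_short n i j a)"
  unfolding inf_short_def Let_def
  by (rule inj_limit_class) (use assms in \<open>auto simp: Omega_def\<close>)

lemma inf_long_eq: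
  assumes "3 \<le> n" "i \<in> Omega n" "\<xi> \<in> L"
  shows "inf_long i \<xi> = StU.inj_limit n (stu_long n i \<xi>)"
  unfolding inf_long_def Let_def
  by (rule inj_limit_class) (use assms in \<open>auto simp: Omega_def\<close>)

lemma StU_inf_family: "steinberg_family bar act B L StU_inf (- {0}) inf_short inf_long"
  unfolding StU_inf_limit
proof (rule family_union)
  fix n :: nat
  assume "3 \<le> n"
  then show "steinberg_family bar act B L StU.limit (Omega n) inf_short inf_long"
    using steinberg_family.family_image[OF StU_family StU.group_limit StU.inj_limit_hom]
      inf_short_eq inf_long_eq by blast
qed

lemma StU_inf_generate:
  "carrier StU_inf \<subseteq> generate StU_inf (steinberg_family.generators L (- {0}) inf_short inf_long)"
proof
  interpret F: steinberg_family bar act B L StU_inf "- {0}" inf_short inf_long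
    by (rule StU_inf_family)
  fix P
  assume "P \<in> carrier StU_inf"
  then obtain n x where n: "3 \<le> n" and x: "x \<in> carrier (StU n)" and P: "P = StU.inj_limit n x"
    unfolding StU_inf_limit by (rule StU.limit_carrierE)
  interpret n: steinberg_family bar act B L "StU n" "Omega n" "stu_short n" "stu_long n"
    by (rule StU_family)
  have "StU.inj_limit n \<in> hom (StU n) StU_inf"
    unfolding StU_inf_limit by (rule StU.inj_limit_hom[OF n])
  then have h: "group_hom (StU n) StU_inf (StU.inj_limit n)"
    by (rule group_hom.intro[OF StU_group F.is_group group_hom_axioms.intro])
  have nonzero: "i \<in> - {0}" if "i \<in> Omega n" for i
    using that n.Omega_nonzero by blast
  have "StU.inj_limit n s \<in> F.generators" if "s \<in> n.generators" for s
    using that unfolding n.generators_def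
  proof (elim UnE CollectE exE conjE)
    fix i j a
    assume "s = stu_short n i j a" "i \<in> Omega n" "j \<in> Omega n" "apart i j"
    then have "StU.inj_limit n s = inf_short i j a" "i \<in> - {0}" "j \<in> - {0}" "apart i j"
      using inf_short_eq[OF n] nonzero by blast+
    then show ?thesis
      unfolding F.generators_def by blast
  next
    fix i \<xi>
    assume "s = stu_long n i \<xi>" "i \<in> Omega n" "\<xi> \<in> L"
    then have "StU.inj_limit n s = inf_long i \<xi>" "i \<in> - {0}" "\<xi> \<in> L"
      using inf_long_eq[OF n] nonzero by blast+
    then show ?thesis
      unfolding F.generators_def by blast
  qed
  then have "StU.inj_limit n ` n.generators \<subseteq> F.generators"
    by blast
  moreover have "P \<in> generate StU_inf (StU.inj_limit n ` n.generators)"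
    using group_hom.generate_img[OF h n.generators_closed] StU_generate[of n] x P by blast
  ultimately show "P \<in> generate StU_inf F.generators"
    using F.mono_generate by blast
qed

lemma StU_inf_universal:
  assumes "steinberg_family bar act B L H (- {0}) ys yl"
  shows "\<exists>h\<in>hom StU_inf H. (\<forall>i\<in>- {0}. \<forall>j\<in>- {0}. \<forall>a. apart i j \<longrightarrow> h (inf_short i j a) = ys i j a)
      \<and> (\<forall>i\<in>- {0}. \<forall>\<xi>\<in>L. h (inf_long i \<xi>) = yl i \<xi>)"
proof -
  interpret H: steinberg_family bar act B L H "- {0}" ys yl
    by (rule assms)
  have "steinberg_family bar act B L H (Omega n) ys yl" for n
    by (rule H.family_subset) (auto simp: Omega_def)
  from StU_universal[OF this]
  obtain h where h: "\<And>n. h n \<in> hom (StU n) H"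
    and short: "\<And>n i j a. \<lbrakk>i \<in> Omega n; j \<in> Omega n; apart i j\<rbrakk> \<Longrightarrow> h n (stu_short n i j a) = ys i j a"
    and long: "\<And>n i \<xi>. \<lbrakk>i \<in> Omega n; \<xi> \<in> L\<rbrakk> \<Longrightarrow> h n (stu_long n i \<xi>) = yl i \<xi>"
    by metis
  have "h (Suc n) (StU_step n x) = h n x" if x: "x \<in> carrier (StU n)" for n x
  proof -
    interpret n: steinberg_family bar act B L "StU n" "Omega n" "stu_short n" "stu_long n"
      by (rule StU_family)
    have "(h (Suc n) \<circ> StU_step n) x = h n x"
    proof (rule hom_eq_on_generate[OF StU_group H.is_group _ h n.generators_closed])
      show "h (Suc n) \<circ> StU_step n \<in> hom (StU n) H"
        using StU_step_hom h by (rule hom_compose)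
      have "i \<in> Omega (Suc n)" if "i \<in> Omega n" for i
        using that Omega_mono[of n "Suc n"] by auto
      then show "(h (Suc n) \<circ> StU_step n) s = h n s" if "s \<in> n.generators" for s
        using that by (auto simp: n.generators_def StU_step_class short long)
      show "x \<in> generate (StU n) n.generators"
        using StU_generate[of n] x by blast
    qed
    then show ?thesis by simp
  qed
  from StU.limit_hom[OF h this] obtain g where g: "g \<in> hom StU_inf H"
    "\<And>n x. \<lbrakk>3 \<le> n; x \<in> carrier (StU n)\<rbrakk> \<Longrightarrow> g (StU.inj_limit n x) = h n x"
    unfolding StU_inf_limit by blast
  have "g (inf_short i j a) = ys i j a" if "i \<noteq> 0" "j \<noteq> 0" "apart i j" for i j a
  proof -
    have "i \<in> Omega (3 + nat \<bar>i\<bar> + nat \<bar>j\<bar>)" "j \<in> Omega (3 + nat \<bar>i\<bar> + nat \<bar>j\<bar>)"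
      using that by (auto simp: Omega_def)
    then show ?thesis
      using that by (simp add: inf_short_def Let_def g short)
  qed
  moreover have "g (inf_long i \<xi>) = yl i \<xi>" if "i \<noteq> 0" "\<xi> \<in> L" for i \<xi>
  proof -
    have "i \<in> Omega (3 + nat \<bar>i\<bar>)"
      using that by (auto simp: Omega_def)
    then show ?thesis
      using that by (simp add: inf_long_def Let_def g long)
  qed
  ultimately show ?thesis
    using g(1) by (intro bexI[of _ g]) (simp_all del: split_paired_All)
qed

lemma StU_inf_schur_multiplier_trivial: "schur_multiplier_trivial TYPE('h) StU_inf"
proof (rule schur_multiplier_trivialI[OF StU_inf_family])
  show "{1..5} \<subseteq> - {0::int}"
    by auto
qed (rule StU_inf_generate StU_inf_universal; assumption?)+

end

theorem theorem1:
  fixes bar :: "'r::{ring, monoid_mult} \<Rightarrow> 'r"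
    and act :: "'v::ab_group_add \<Rightarrow> 'r \<Rightarrow> 'v"
    and B :: "'v \<Rightarrow> 'v \<Rightarrow> 'r"
    and L :: "('v \<times> 'r) set"
  assumes "odd_quadratic_space bar act B L"
  shows "(\<forall>n\<ge>5. schur_multiplier_trivial TYPE('h) (odd_quadratic_space.StU bar act B L n)) \<and>
         schur_multiplier_trivial TYPE('h) (odd_quadratic_space.StU_inf bar act B L)"
  using odd_quadratic_space.StU_schur_multiplier_trivial[OF assms]
    odd_quadratic_space.StU_inf_schur_multiplier_trivial[OF assms]
  by blast

end
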